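(* Let $\mu=\mathcal N(0,\mathcal C)$ be a centered Gaussian on $\mathbb R^{n_u}\times\mathbb R^{n_v}$ with strictly positive-definite covariance $\mathcal C=\begin{bmatrix}\mathcal C_{uu}&\mathcal C_{uv}\\ \mathcal C_{vu}&\mathcal C_{vv}\end{bmatrix}$, and marginals $\mu_u=\mathcal N(0,\mathcal C_{uu})$, $\mu_v=\mathcal N(0,\mathcal C_{vv})$. For $A\in\mathbb R^{n_u\times n_v}$ let $$\mathsf L_{\mathsf{cond}}(A)=-\mathbb E_{(u,v)\sim\mu}\bigl[\langle u,Av\rangle\bigr]+\tfrac12\mathbb E_{u\sim\mu_u}\log\mathbb E_{v\sim\mu_v}\bigl[e^{\langle u,Av\rangle}\bigr]+\tfrac12\mathbb E_{v\sim\mu_v}\log\mathbb E_{u\sim\mu_u}\bigl[e^{\langle u,Av\rangle}\bigr].$$ The minimizer of $\mathsf L_{\mathsf{cond}}(A)$ over all matrices of size $n_u\times n_v$ is $$A^\ast=\mathcal C_{uu}^{-1}\mathcal C_{uv}\mathcal C_{vv}^{-1}.$$ The minimizer of $\mathsf L_{\mathsf{cond}}(A)$ over the set of rank-$r$ matrices $\mathcal A_r=\{A\in\mathbb R^{n_u\times n_v}:\operatorname{rank}(A)\le r\}$, for $0<r\le\min(n_u,n_v)$, is given by $$A^\ast(r)=\mathcal C_{uu}^{-1/2}\bigl(\mathcal C_{uu}^{-1/2}\mathcal C_{uv}\mathcal C_{vv}^{-1/2}\bigr)_r\,\mathcal C_{vv}^{-1/2}.$$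
   Context: For any matrix $M$, $M_r$ denotes the rank-$r$ truncation of its singular value decomposition (the optimal rank-$r$ approximation of $M$ in the Frobenius norm). Matrix square roots of positive-definite matrices are the symmetric positive-definite ones. $\langle\cdot,\cdot\rangle$ is the Euclidean inner product. *)

theory Defs
  imports "HOL-Probability.Probability"
begin

definition pos_def :: "real^'n^'n \<Rightarrow> bool" where
  "pos_def C \<longleftrightarrow> transpose C = C \<and> (\<forall>x. x \<noteq> 0 \<longrightarrow> x \<bullet> (C *v x) > 0)"

text \<open>Only meaningful for positive-definite \<open>C\<close>, for which there is exactly one such \<open>S\<close>.\<close>

definition msqrt :: "real^'n^'n \<Rightarrow> real^'n^'n" where
  "msqrt C = (THE S. pos_def S \<and> S ** S = C)"

text \<open>The law \<open>N(0, C)\<close>, for positive-definite \<open>C\<close>, through its Lebesgue density.\<close>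

definition gaussian :: "real^'n^'n \<Rightarrow> (real^'n) measure" where
  "gaussian C = density lborel
     (\<lambda>x. ennreal (exp (- (x \<bullet> (matrix_inv C *v x)) / 2) / sqrt ((2 * pi) ^ CARD('n) * det C)))"

text \<open>A covariance on \<open>(real^'u) \<times> (real^'v)\<close> is a matrix indexed by the
  disjoint sum of the two index types.\<close>

definition block_uu :: "real^('u::finite + 'v::finite)^('u + 'v) \<Rightarrow> real^'u^'u" where
  "block_uu C = (\<chi> i j. C $ Inl i $ Inl j)"

definition block_uv :: "real^('u::finite + 'v::finite)^('u + 'v) \<Rightarrow> real^'v^'u" where
  "block_uv C = (\<chi> i j. C $ Inl i $ Inr j)"

definition block_vv :: "real^('u::finite + 'v::finite)^('u + 'v) \<Rightarrow> real^'v^'v" where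
  "block_vv C = (\<chi> i j. C $ Inr i $ Inr j)"

definition joint_gaussian ::
    "real^('u::finite + 'v::finite)^('u + 'v) \<Rightarrow> ((real^'u) \<times> (real^'v)) measure" where
  "joint_gaussian C = distr (gaussian C) borel (\<lambda>w. (\<chi> i. w $ Inl i, \<chi> j. w $ Inr j))"

text \<open>For positive-definite \<open>C\<close> all the integrals below exist for every \<open>A\<close>, so the convention
  that a non-integrable function has integral 0 plays no role.\<close>

definition L_cond :: "real^('u::finite + 'v::finite)^('u + 'v) \<Rightarrow> real^'v^'u \<Rightarrow> real" where
  "L_cond C A =
     - (\<integral>p. fst p \<bullet> (A *v snd p) \<partial>joint_gaussian C)
     + 1/2 * (\<integral>u. ln (\<integral>v. exp (u \<bullet> (A *v v)) \<partial>gaussian (block_vv C)) \<partial>gaussian (block_uu C))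
     + 1/2 * (\<integral>v. ln (\<integral>u. exp (u \<bullet> (A *v v)) \<partial>gaussian (block_uu C)) \<partial>gaussian (block_vv C))"

text \<open>A (reduced) singular value decomposition \<open>M = \<Sum>k. s k * x k * (y k)\<^sup>T\<close>; only the indices
  below the smaller dimension of \<open>M\<close> matter.\<close>

definition is_svd ::
    "real^'n^'m \<Rightarrow> (nat \<Rightarrow> real) \<Rightarrow> (nat \<Rightarrow> real^'m) \<Rightarrow> (nat \<Rightarrow> real^'n) \<Rightarrow> bool" where
  "is_svd M s x y \<longleftrightarrow>
     (\<forall>k < min CARD('m) CARD('n). 0 \<le> s k) \<and>
     (\<forall>k < min CARD('m) CARD('n). \<forall>j \<le> k. s k \<le> s j) \<and>
     (\<forall>j < min CARD('m) CARD('n). \<forall>k < min CARD('m) CARD('n).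
        x j \<bullet> x k = (if j = k then 1 else 0) \<and> y j \<bullet> y k = (if j = k then 1 else 0)) \<and>
     M = (\<Sum>k < min CARD('m) CARD('n). s k *\<^sub>R (\<chi> i j. x k $ i * y k $ j))"

text \<open>\<open>T\<close> is a rank-\<open>r\<close> truncation \<open>M\<^sub>r\<close> of \<open>M\<close>. This is a relation because \<open>M\<^sub>r\<close> depends on the
  chosen decomposition when the \<open>r\<close>-th and \<open>(r+1)\<close>-st singular values coincide and are nonzero;
  otherwise it determines \<open>T\<close>. To be used with \<open>r\<close> at most the smaller dimension of \<open>M\<close>.\<close>

definition svd_truncation :: "nat \<Rightarrow> real^'n^'m \<Rightarrow> real^'n^'m \<Rightarrow> bool" where
  "svd_truncation r M T \<longleftrightarrow>
     (\<exists>s x y. is_svd M s x y \<and> T = (\<Sum>k<r. s k *\<^sub>R (\<chi> i j. x k $ i * y k $ j)))"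

end

theory Submission
  imports Defs "HOL-Real_Asymp.Real_Asymp"
begin

text \<open>Write \<open>S\<close> and \<open>R\<close> for the square roots of the marginal covariances, and
  \<open>M = S\<^sup>-\<^sup>1 C\<^sub>u\<^sub>v R\<^sup>-\<^sup>1\<close>. The Gaussian moment generating function turns each logarithm into a
  quadratic form, whose expectation is \<open>\<parallel>S A R\<parallel>\<^sup>2 / 2\<close> in the Frobenius norm, so that
  \<open>L_cond C A = \<parallel>M - S A R\<parallel>\<^sup>2 / 2 - \<parallel>M\<parallel>\<^sup>2 / 2\<close>. As \<open>A \<mapsto> S A R\<close> is a rank-preserving bijection, what
  remains is the Eckart--Young theorem together with its converse: every best approximation \<open>T\<close> of
  rank at most \<open>r\<close> is a truncation of some singular value decomposition. First-order optimality makes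
  the rows and columns of \<open>M - T\<close> orthogonal to those of \<open>T\<close>, so singular value decompositions of
  \<open>T\<close> and \<open>M - T\<close> combine to one of \<open>M\<close>, and exchanging one singular pair shows that those of
  \<open>T\<close> come first.\<close>

section \<open>Singular value decompositions\<close>

text \<open>The rank-one matrix a b^T, given the name so that the sums in \<open>is_svd\<close> and
  \<open>svd_truncation\<close> can be handled term by term.\<close>

definition outer :: "real^'m \<Rightarrow> real^'n \<Rightarrow> real^'n^'m" where
  "outer a b = (\<chi> i j. a $ i * b $ j)"

lemma outer_mult_vec: "outer a b *v z = (b \<bullet> z) *\<^sub>R a"
  by (simp add: outer_def vec_eq_iff matrix_vector_mult_def inner_vec_def sum_distrib_right
      sum_distrib_left mult_ac)

lemma vec_mult_outer: "z v* outer a b = (a \<bullet> z) *\<^sub>R b"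
  by (simp add: outer_def vec_eq_iff vector_matrix_mult_def inner_vec_def sum_distrib_right
      sum_distrib_left mult_ac)

lemma outer_scaleR_left: "outer (c *\<^sub>R a) b = c *\<^sub>R outer a b"
  by (simp add: outer_def vec_eq_iff)

lemma outer_add_left: "outer (a + a') b = outer a b + outer a' b"
  by (simp add: outer_def vec_eq_iff algebra_simps)

lemma outer_add_right: "outer a (b + b') = outer a b + outer a b'"
  by (simp add: outer_def vec_eq_iff algebra_simps)

lemma outer_zero [simp]: "outer 0 b = 0" "outer a 0 = 0"
  by (simp_all add: outer_def vec_eq_iff)

lemma outer_scaleR_right: "outer a (c *\<^sub>R b) = c *\<^sub>R outer a b"
  by (simp add: outer_def vec_eq_iff)

text \<open>The inner product on matrices is the Frobenius one, so pairing with a b^T evaluates the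
  bilinear form of \<open>M\<close> at \<open>a\<close> and \<open>b\<close>.\<close>

lemma inner_outer: "M \<bullet> outer a b = a \<bullet> (M *v b)"
  by (simp add: outer_def inner_vec_def matrix_vector_mult_def sum_distrib_left mult_ac)

lemma mult_vec_sum: "(\<Sum>k\<in>K. F k) *v z = (\<Sum>k\<in>K. F k *v z)" for F :: "'a \<Rightarrow> real^'n^'m"
  by (induction K rule: infinite_finite_induct) (auto simp: matrix_vector_mult_add_rdistrib)

lemma vec_mult_sum: "z v* (\<Sum>k\<in>K. F k) = (\<Sum>k\<in>K. z v* F k)" for F :: "'a \<Rightarrow> real^'n^'m"
  by (induction K rule: infinite_finite_induct) (auto simp: vector_matrix_mult_add_rdistrib)

lemma scaleR_mult_vec: "(c *\<^sub>R M) *v z = c *\<^sub>R (M *v z)" for M :: "real^'n^'m"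
  by (simp add: scaleR_matrix_vector_assoc)

lemma vec_mult_scaleR: "z v* (c *\<^sub>R M) = c *\<^sub>R (z v* M)" for M :: "real^'n^'m"
  by (simp add: vector_matrix_mult_def vec_eq_iff sum_distrib_left mult_ac)

lemma inner_mult_vec: "a \<bullet> (M *v b) = (a v* M) \<bullet> b" for M :: "real^'n^'m"
  by (simp add: dot_lmul_matrix)

text \<open>The range lies in the span of the \<open>n\<close> left factors. Scalar weights are
  absorbed into one of the factors when this is applied.\<close>

lemma rank_sum_outer_le:
  "rank (\<Sum>k<n. outer (a k) (b k) :: real^'n^'m) \<le> n"
proof -
  let ?T = "\<Sum>k<n. outer (a k) (b k) :: real^'n^'m"
  have "range ((*v) ?T) \<subseteq> span (a ` {..<n})"
  proof clarify
    fix z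
    show "?T *v z \<in> span (a ` {..<n})"
      unfolding mult_vec_sum outer_mult_vec by (intro span_sum span_scale span_base) auto
  qed
  then have "dim (range ((*v) ?T)) \<le> card (a ` {..<n})"
    by (intro dim_le_card) auto
  also have "\<dots> \<le> n"
    using card_image_le[of "{..<n}" a] by simp
  finally show ?thesis
    by (simp add: rank_dim_range)
qed

section \<open>Orthonormal families\<close>

text \<open>Families are functions on the naturals, as in \<open>is_svd\<close>, with values from
  \<open>n\<close> on left free; this makes appending and extending them easy.\<close>

definition orthonormal_upto :: "nat \<Rightarrow> (nat \<Rightarrow> 'a::real_inner) \<Rightarrow> bool" where
  "orthonormal_upto n x \<longleftrightarrow> (\<forall>j<n. \<forall>k<n. x j \<bullet> x k = (if j = k then 1 else 0))"

lemma orthonormal_upto_append: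
  assumes "orthonormal_upto m x" "orthonormal_upto n y"
    and "\<And>j k. j < m \<Longrightarrow> k < n \<Longrightarrow> x j \<bullet> y k = 0"
  shows "orthonormal_upto (m + n) (\<lambda>k. if k < m then x k else y (k - m))"
  unfolding orthonormal_upto_def
proof (intro allI impI)
  fix j k assume "j < m + n" "k < m + n"
  then show "(if j < m then x j else y (j - m)) \<bullet> (if k < m then x k else y (k - m)) =
      (if j = k then 1 else 0)"
    using assms(1,2) assms(3)[of j "k - m"] assms(3)[of k "j - m"]
    by (auto simp: orthonormal_upto_def inner_commute)
qed

lemma orthonormal_upto_card_le_dim:
  fixes x :: "nat \<Rightarrow> 'a::euclidean_space"
  assumes "orthonormal_upto n x" "x ` {..<n} \<subseteq> V"
  shows "n \<le> dim V"
proof -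
  have inj: "inj_on x {..<n}"
    using assms(1) by (intro inj_onI) (metis lessThan_iff orthonormal_upto_def zero_neq_one)
  have "pairwise orthogonal (x ` {..<n})"
    using assms(1) by (auto simp: pairwise_def orthogonal_def orthonormal_upto_def)
  moreover have "0 \<notin> x ` {..<n}"
    using assms(1) by (force simp: orthonormal_upto_def)
  ultimately have "independent (x ` {..<n})"
    by (rule pairwise_orthogonal_independent)
  then have "card (x ` {..<n}) \<le> dim V"
    using assms(2) independent_card_le_dim by blast
  then show ?thesis
    by (simp add: card_image inj)
qed

text \<open>Fewer than \<open>DIM('a)\<close> vectors do not span, so there is a nonzero vector
  orthogonal to all of them; normalise it and append it.\<close>

lemma orthonormal_upto_extend:
  fixes x :: "nat \<Rightarrow> 'a::euclidean_space"
  assumes "orthonormal_upto n x" "n \<le> N" "N \<le> DIM('a)"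
  shows "\<exists>x'. orthonormal_upto N x' \<and> (\<forall>k<n. x' k = x k)"
  using assms(2,3)
proof (induction N rule: dec_induct)
  case base
  then show ?case using assms(1) by blast
next
  case (step N)
  then obtain x' where x': "orthonormal_upto N x'" "\<forall>k<n. x' k = x k"
    by auto
  have "dim (x' ` {..<N}) \<le> card (x' ` {..<N})"
    by (intro dim_le_card') auto
  also have "\<dots> \<le> N"
    using card_image_le[of "{..<N}" x'] by simp
  finally obtain z where z: "z \<noteq> 0" "\<And>w. w \<in> span (x' ` {..<N}) \<Longrightarrow> orthogonal z w"
    using orthogonal_to_subspace_exists[of "x' ` {..<N}"] step.prems by auto
  have "orthonormal_upto (N + 1) (\<lambda>k. if k < N then x' k else z /\<^sub>R norm z)"
  proof (rule orthonormal_upto_append[OF x'(1)])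
    show "orthonormal_upto 1 (\<lambda>_. z /\<^sub>R norm z)"
      using z(1) by (simp add: orthonormal_upto_def dot_square_norm power2_eq_square)
    show "x' j \<bullet> (z /\<^sub>R norm z) = 0" if "j < N" for j
      using z(2)[OF span_base, of "x' j"] that by (simp add: orthogonal_def inner_commute)
  qed
  then show ?case
    using x'(2) step.hyps by (intro exI[of _ "\<lambda>k. if k < N then x' k else z /\<^sub>R norm z"]) auto
qed

text \<open>The weights have the shape that arises when a sum of rank-one matrices is applied to one
  of its own singular vectors.\<close>

lemma sum_orthonormal_select:
  fixes n :: nat
  assumes "orthonormal_upto n y" "k < n"
  shows "(\<Sum>j<n. (f j * (y j \<bullet> y k)) *\<^sub>R g j) = f k *\<^sub>R (g k :: 'b::real_vector)"
proof -
  have "(\<Sum>j<n. (f j * (y j \<bullet> y k)) *\<^sub>R g j) = (\<Sum>j<n. if j = k then f k *\<^sub>R g k else 0)"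
    using assms by (intro sum.cong) (auto simp: orthonormal_upto_def)
  then show ?thesis
    using assms(2) by simp
qed

lemma orthonormal_norm_sum:
  fixes c :: "nat \<Rightarrow> real"
  assumes "orthonormal_upto n y"
  shows "(norm (\<Sum>k<n. c k *\<^sub>R y k))\<^sup>2 = (\<Sum>k<n. (c k)\<^sup>2)"
proof -
  let ?p = "\<Sum>k<n. c k *\<^sub>R y k"
  have "v \<bullet> ?p = (\<Sum>k<n. c k * (v \<bullet> y k))" for v
    by (simp add: inner_sum_right)
  then have "?p \<bullet> ?p = (\<Sum>k<n. c k * (?p \<bullet> y k))" .
  also have "\<dots> = (\<Sum>k<n. (c k)\<^sup>2)"
    using sum_orthonormal_select[OF assms, of _ c "\<lambda>_. 1::real"]
    by (intro sum.cong) (auto simp: inner_sum_left power2_eq_square)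
  finally show ?thesis
    by (simp flip: power2_norm_eq_inner)
qed

text \<open>Bessel's inequality: the distance from \<open>q\<close> to its projection
  \<open>?p\<close> has nonnegative square.\<close>

lemma bessel_upto:
  assumes "orthonormal_upto n x"
  shows "(\<Sum>k<n. (x k \<bullet> q)\<^sup>2) \<le> (norm q)\<^sup>2"
proof -
  let ?p = "\<Sum>k<n. (x k \<bullet> q) *\<^sub>R x k"
  have pp: "?p \<bullet> ?p = (\<Sum>k<n. (x k \<bullet> q)\<^sup>2)"
    using orthonormal_norm_sum[OF assms] by (simp add: power2_norm_eq_inner)
  have pq: "?p \<bullet> q = (\<Sum>k<n. (x k \<bullet> q)\<^sup>2)"
    by (simp add: inner_sum_left power2_eq_square)
  have "0 \<le> (q - ?p) \<bullet> (q - ?p)" by simp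
  also have "\<dots> = q \<bullet> q - 2 * (?p \<bullet> q) + ?p \<bullet> ?p"
    by (simp add: inner_diff_left inner_diff_right inner_commute)
  finally show ?thesis
    using pp pq by (simp add: dot_square_norm)
qed

section \<open>Existence of singular value decompositions\<close>

text \<open>Unlike \<open>is_svd\<close>, only the positive singular values are listed. The length
  \<open>n\<close> is then the rank, and one may divide by each \<open>s k\<close>.\<close>

definition compact_svd ::
  "nat \<Rightarrow> (nat \<Rightarrow> real) \<Rightarrow> (nat \<Rightarrow> real^'m) \<Rightarrow> (nat \<Rightarrow> real^'n) \<Rightarrow> real^'n^'m \<Rightarrow> bool" where
  "compact_svd n s x y M \<longleftrightarrow> (\<forall>k<n. 0 < s k) \<and> (\<forall>k<n. \<forall>j\<le>k. s k \<le> s j) \<and>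
     orthonormal_upto n x \<and> orthonormal_upto n y \<and> M = (\<Sum>k<n. s k *\<^sub>R outer (x k) (y k))"

lemma sum_outer_mult_vec:
  assumes "orthonormal_upto n y" "k < n"
  shows "(\<Sum>j<n. s j *\<^sub>R outer (x j) (y j)) *v y k = s k *\<^sub>R x k"
  by (simp add: mult_vec_sum scaleR_mult_vec outer_mult_vec sum_orthonormal_select[OF assms])

lemma vec_mult_sum_outer:
  assumes "orthonormal_upto n x" "k < n"
  shows "x k v* (\<Sum>j<n. s j *\<^sub>R outer (x j) (y j)) = s k *\<^sub>R y k"
  by (simp add: vec_mult_sum vec_mult_scaleR vec_mult_outer sum_orthonormal_select[OF assms])

lemma compact_svd_rank:
  assumes "compact_svd n s x y M"
  shows "rank M = n"
proof (rule antisym)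
  have M: "M = (\<Sum>k<n. s k *\<^sub>R outer (x k) (y k))" and s: "\<And>k. k < n \<Longrightarrow> 0 < s k"
    and ox: "orthonormal_upto n x" and oy: "orthonormal_upto n y"
    using assms by (auto simp: compact_svd_def)
  show "rank M \<le> n"
    unfolding M outer_scaleR_left[symmetric] by (rule rank_sum_outer_le)
  have "x k \<in> range ((*v) M)" if "k < n" for k
    using sum_outer_mult_vec[OF oy that, of s x] s[OF that]
    by (intro image_eqI[of _ _ "inverse (s k) *\<^sub>R y k"]) (auto simp: M matrix_vector_mult_scaleR)
  then show "n \<le> rank M"
    unfolding rank_dim_range by (intro orthonormal_upto_card_le_dim[OF ox]) auto
qed

text \<open>Testing maximality with \<open>w /\<^sub>R norm w\<close> gives equality in
  Cauchy-Schwarz, which makes \<open>w\<close> a multiple of \<open>v\<close>.\<close>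

lemma inner_maximal_on_sphere:
  fixes v w :: "'a::real_inner"
  assumes "norm v = 1" and max: "\<And>u. norm u = 1 \<Longrightarrow> u \<bullet> w \<le> v \<bullet> w" and "0 < v \<bullet> w"
  shows "w = (v \<bullet> w) *\<^sub>R v"
proof -
  have w: "w \<noteq> 0" using assms(3) by auto
  have "norm w = (w /\<^sub>R norm w) \<bullet> w"
    using w by (simp add: dot_square_norm power2_eq_square)
  also have "\<dots> \<le> v \<bullet> w"
    using w by (intro max) auto
  finally have "norm w \<le> v \<bullet> w" .
  moreover have "v \<bullet> w \<le> norm w"
    using norm_cauchy_schwarz[of v w] assms(1) by simp
  ultimately have "v \<bullet> w = norm w"
    by (rule antisym[rotated])
  moreover from this have "norm v *\<^sub>R w = norm w *\<^sub>R v"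
    using assms(1) by (subst norm_cauchy_schwarz_eq[symmetric]) simp
  ultimately show ?thesis
    using assms(1) by simp
qed

text \<open>Maximise the bilinear form of \<open>M\<close> over the compact product of the unit
  spheres. With one vector of a maximiser fixed, the other maximises a linear functional on its
  sphere, which gives the two singular equations.\<close>

lemma top_singular_pair:
  fixes M :: "real^'n^'m"
  assumes "M \<noteq> 0"
  obtains \<sigma> a b where "0 < \<sigma>" "norm a = 1" "norm b = 1" "M *v b = \<sigma> *\<^sub>R a" "a v* M = \<sigma> *\<^sub>R b"
    "\<And>c d. norm c = 1 \<Longrightarrow> norm d = 1 \<Longrightarrow> c \<bullet> (M *v d) \<le> \<sigma>"
proof -
  let ?S = "sphere 0 1 \<times> sphere 0 1 :: ((real^'m) \<times> (real^'n)) set"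
  let ?f = "\<lambda>p. fst p \<bullet> (M *v snd p)"
  obtain e :: "real^'m" where e: "norm e = 1"
    using vector_choose_size[of 1] by auto
  obtain e' :: "real^'n" where e': "norm e' = 1"
    using vector_choose_size[of 1] by auto
  have "compact ?S"
    by (intro compact_Times compact_sphere)
  moreover have "?S \<noteq> {}"
    using e e' by auto
  moreover have "continuous_on ?S ?f"
    by (intro continuous_intros linear_continuous_on_compose[OF continuous_on_snd]) auto
  ultimately have "\<exists>p\<in>?S. \<forall>q\<in>?S. ?f q \<le> ?f p"
    by (rule continuous_attains_sup)
  then obtain p where p: "p \<in> ?S" "\<And>q. q \<in> ?S \<Longrightarrow> ?f q \<le> ?f p"
    by blast
  define a where "a = fst p"
  define b where "b = snd p"
  define \<sigma> where "\<sigma> = a \<bullet> (M *v b)"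
  have nab: "norm a = 1" "norm b = 1"
    using p(1) by (auto simp: a_def b_def mem_Times_iff)
  have max: "c \<bullet> (M *v d) \<le> \<sigma>" if "norm c = 1" "norm d = 1" for c d
    using p(2)[of "(c, d)"] that by (simp add: a_def b_def \<sigma>_def)
  obtain d where "M *v d \<noteq> 0"
    using assms by (auto simp: matrix_eq)
  then have d: "M *v d \<noteq> 0" "d \<noteq> 0" by auto
  have "0 < (M *v d /\<^sub>R norm (M *v d)) \<bullet> (M *v (d /\<^sub>R norm d))"
    using d by (simp add: matrix_vector_mult_scaleR dot_square_norm)
  also have "\<dots> \<le> \<sigma>"
    using d by (intro max) auto
  finally have \<sigma>: "0 < \<sigma>" .
  have "M *v b = \<sigma> *\<^sub>R a"
    using inner_maximal_on_sphere[of a "M *v b"] max nab \<sigma> by (auto simp: \<sigma>_def)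
  moreover have "a v* M = \<sigma> *\<^sub>R b"
    using inner_maximal_on_sphere[of b "a v* M"] max nab \<sigma>
    by (auto simp: \<sigma>_def inner_mult_vec inner_commute)
  ultimately show ?thesis
    using that \<sigma> nab max by blast
qed

text \<open>Induction on the rank: subtract the top singular term, decompose the remainder
  \<open>M'\<close>, and put the top pair in front. Since \<open>M'\<close> annihilates
  \<open>b\<close> and \<open>a\<close> from the two sides, its singular vectors are orthogonal to
  them.\<close>

lemma compact_svd_exists: "\<exists>n s x y. compact_svd n s x y M"
proof (induction "rank M" arbitrary: M rule: less_induct)
  case less
  show ?case
  proof (cases "M = 0")
    case True
    then have "compact_svd 0 s x y M" for s x y
      by (simp add: compact_svd_def orthonormal_upto_def)
    then show ?thesis by blast
  next
    case False
    obtain \<sigma> a b where \<sigma>: "0 < \<sigma>" and a: "norm a = 1" and b: "norm b = 1"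
      and Mb: "M *v b = \<sigma> *\<^sub>R a" and Ma: "a v* M = \<sigma> *\<^sub>R b"
      and max: "\<And>c d. norm c = 1 \<Longrightarrow> norm d = 1 \<Longrightarrow> c \<bullet> (M *v d) \<le> \<sigma>"
      by (rule top_singular_pair[OF False]) (use that in blast)
    define M' where "M' = M - \<sigma> *\<^sub>R outer a b"
    have aa: "a \<bullet> a = 1" and bb: "b \<bullet> b = 1"
      using a b by (simp_all add: dot_square_norm)
    have M'v: "M' *v z = M *v z - (\<sigma> * (b \<bullet> z)) *\<^sub>R a" for z
      by (simp add: M'_def matrix_vector_mult_diff_rdistrib scaleR_mult_vec outer_mult_vec)
    have vM': "z v* M' = z v* M - (\<sigma> * (a \<bullet> z)) *\<^sub>R b" for z
      by (simp add: M'_def vector_matrix_mult_diff_rdistrib vec_mult_scaleR vec_mult_outer)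
    have M'b: "M' *v b = 0" and M'a: "a v* M' = 0"
      using Mb Ma aa bb by (simp_all add: M'v vM')
    have "range ((*v) M') \<subseteq> range ((*v) M)"
    proof clarify
      fix z
      have "M' *v z = M *v (z - (b \<bullet> z) *\<^sub>R b)"
        by (simp add: M'v matrix_vector_mult_diff_distrib matrix_vector_mult_scaleR Mb mult.commute)
      then show "M' *v z \<in> range ((*v) M)" by blast
    qed
    \<comment> \<open>The range strictly shrinks because it loses \<open>a\<close>: the row vector
      a^T M' is zero, whereas \<open>a\<close> is the image of a multiple of \<open>b\<close> under
      \<open>M\<close>.\<close>
    moreover have "a \<notin> range ((*v) M')"
    proof
      assume "a \<in> range ((*v) M')"
      then obtain z where "a = M' *v z" by auto
      then have "a \<bullet> a = (a v* M') \<bullet> z"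
        by (metis inner_mult_vec)
      then show False using aa M'a by simp
    qed
    moreover have "a \<in> range ((*v) M)"
      using Mb \<sigma> by (intro image_eqI[of _ _ "inverse \<sigma> *\<^sub>R b"]) (auto simp: matrix_vector_mult_scaleR)
    ultimately have "range ((*v) M') \<subset> range ((*v) M)"
      by blast
    then have "rank M' < rank M"
      unfolding rank_dim_range
      by (intro dim_psubset) (simp add: span_eq_iff[THEN iffD2] linear_subspace_image)
    then obtain n s x y where svd: "compact_svd n s x y M'"
      using less by blast
    have M': "M' = (\<Sum>k<n. s k *\<^sub>R outer (x k) (y k))" and s: "\<And>k. k < n \<Longrightarrow> 0 < s k"
      and dec: "\<And>j k. k < n \<Longrightarrow> j \<le> k \<Longrightarrow> s k \<le> s j"
      and ox: "orthonormal_upto n x" and oy: "orthonormal_upto n y"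
      using svd by (auto simp: compact_svd_def)
    have M'y: "M' *v y k = s k *\<^sub>R x k" and M'x: "x k v* M' = s k *\<^sub>R y k" if "k < n" for k
      unfolding M' using sum_outer_mult_vec[OF oy that] vec_mult_sum_outer[OF ox that] by auto
    have ax: "a \<bullet> x k = 0" if "k < n" for k
    proof -
      have "s k * (a \<bullet> x k) = (a v* M') \<bullet> y k"
        by (simp add: M'y that flip: inner_mult_vec)
      then show ?thesis using M'a s[OF that] by simp
    qed
    have byz: "b \<bullet> y k = 0" if "k < n" for k
    proof -
      have "s k * (b \<bullet> y k) = (x k v* M') \<bullet> b"
        by (simp add: M'x that inner_commute)
      then show ?thesis using M'b s[OF that] by (simp flip: inner_mult_vec)
    qed
    have nx: "norm (x k) = 1" "norm (y k) = 1" if "k < n" for k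
      using ox oy that by (auto simp: orthonormal_upto_def norm_eq_1)
    \<comment> \<open>\<open>M\<close> and \<open>M'\<close> agree on \<open>y k\<close>, which is
      orthogonal to \<open>b\<close>; so maximality of \<open>\<sigma>\<close> for \<open>M\<close>
      also bounds the singular values of \<open>M'\<close>.\<close>
    have s_le: "s k \<le> \<sigma>" if "k < n" for k
    proof -
      have "s k = x k \<bullet> (M' *v y k)"
        using ox that by (simp add: M'y orthonormal_upto_def)
      also have "\<dots> = x k \<bullet> (M *v y k)"
        by (simp add: M'v byz that)
      also have "\<dots> \<le> \<sigma>"
        by (intro max nx that)
      finally show ?thesis .
    qed
    \<comment> \<open>\<open>case_nat\<close> prepends the top pair, shifting the other indices by
      one.\<close>
    let ?s = "case_nat \<sigma> s" and ?x = "case_nat a x" and ?y = "case_nat b y"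
    have "M = (\<Sum>k<Suc n. ?s k *\<^sub>R outer (?x k) (?y k))"
      unfolding sum.lessThan_Suc_shift using M' by (simp add: M'_def algebra_simps)
    moreover have "orthonormal_upto (Suc n) ?x" "orthonormal_upto (Suc n) ?y"
      using ox oy aa bb ax byz
      by (auto simp: orthonormal_upto_def less_Suc_eq_0_disj inner_commute split: nat.split)
    moreover have "\<forall>k<Suc n. 0 < ?s k"
      using s \<sigma> by (auto split: nat.split)
    moreover have "\<forall>k<Suc n. \<forall>j\<le>k. ?s k \<le> ?s j"
      using dec s_le by (auto split: nat.split)
    ultimately have "compact_svd (Suc n) ?s ?x ?y M"
      unfolding compact_svd_def by blast
    then show ?thesis by blast
  qed
qed

lemma is_svd_iff:
  fixes M :: "real^'n^'m"
  defines "p \<equiv> min CARD('m) CARD('n)"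
  shows "is_svd M s x y \<longleftrightarrow> (\<forall>k<p. 0 \<le> s k) \<and> (\<forall>k<p. \<forall>j\<le>k. s k \<le> s j) \<and>
     orthonormal_upto p x \<and> orthonormal_upto p y \<and> M = (\<Sum>k<p. s k *\<^sub>R outer (x k) (y k))"
  unfolding is_svd_def p_def orthonormal_upto_def outer_def by blast

text \<open>Pad with zero singular values along extended orthonormal families. The first
  \<open>n\<close> vectors are kept so that partial sums can still be identified afterwards.\<close>

lemma compact_svd_extend:
  fixes M :: "real^'n^'m"
  assumes "compact_svd n s x y M"
  shows "\<exists>x' y'. is_svd M (\<lambda>k. if k < n then s k else 0) x' y' \<and> (\<forall>k<n. x' k = x k \<and> y' k = y k)"
proof -
  let ?p = "min CARD('m) CARD('n)"
  let ?s = "\<lambda>k. if k < n then s k else 0"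
  have n: "n \<le> ?p"
    using compact_svd_rank[OF assms] rank_bound by metis
  have svd: "\<And>k. k < n \<Longrightarrow> 0 < s k" "\<And>j k. k < n \<Longrightarrow> j \<le> k \<Longrightarrow> s k \<le> s j"
    "orthonormal_upto n x" "orthonormal_upto n y" "M = (\<Sum>k<n. s k *\<^sub>R outer (x k) (y k))"
    using assms by (auto simp: compact_svd_def)
  obtain x' where x': "orthonormal_upto ?p x'" "\<forall>k<n. x' k = x k"
    using orthonormal_upto_extend[OF svd(3) n] by auto
  obtain y' where y': "orthonormal_upto ?p y'" "\<forall>k<n. y' k = y k"
    using orthonormal_upto_extend[OF svd(4) n] by auto
  have "(\<Sum>k<?p. ?s k *\<^sub>R outer (x' k) (y' k)) = (\<Sum>k<n. ?s k *\<^sub>R outer (x' k) (y' k))"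
    using n by (intro sum.mono_neutral_right) auto
  also have "\<dots> = M"
    unfolding svd(5) using x'(2) y'(2) by (intro sum.cong) auto
  finally have "is_svd M ?s x' y'"
    unfolding is_svd_iff using x'(1) y'(1) svd(1,2) by (auto simp: less_imp_le)
  then show ?thesis
    using x'(2) y'(2) by blast
qed

lemma svd_exists: "\<exists>s x y. is_svd M s x y"
  using compact_svd_exists compact_svd_extend by metis

section \<open>Best low-rank approximation\<close>

lemma norm_diff_square: "(norm (a - b))\<^sup>2 = (norm a)\<^sup>2 - 2 * (a \<bullet> b) + (norm b)\<^sup>2"
  for a b :: "'a::real_inner"
  unfolding power2_norm_eq_inner by (simp add: inner_diff_left inner_diff_right inner_commute)

lemma sum_lessThan_add:
  "(\<Sum>k<m + n. f k) = (\<Sum>k<m. f k) + (\<Sum>k<n. f (m + k))" for f :: "nat \<Rightarrow> 'a::comm_monoid_add"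
  by (induction n) (simp_all add: add.assoc)

lemma inner_sum_outer:
  assumes "orthonormal_upto n x" "orthonormal_upto n y"
  shows "(\<Sum>k<n. s k *\<^sub>R outer (x k) (y k)) \<bullet> (\<Sum>k<n. t k *\<^sub>R outer (x k) (y k)) = (\<Sum>k<n. s k * t k)"
  using assms
  by (simp add: inner_sum_right inner_outer sum_outer_mult_vec orthonormal_upto_def mult.commute)

lemma norm_sum_outer:
  assumes "orthonormal_upto n x" "orthonormal_upto n y"
  shows "(norm (\<Sum>k<n. s k *\<^sub>R outer (x k) (y k)))\<^sup>2 = (\<Sum>k<n. (s k)\<^sup>2)"
  unfolding power2_norm_eq_inner using inner_sum_outer[OF assms, of s s]
  by (simp only: power2_eq_square)

section \<open>The Eckart-Young theorem\<close>

text \<open>Compare everything with \<open>w r\<close>: the mass of \<open>c\<close> beyond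
  \<open>r\<close> is at most the mass missing from \<open>1\<close> at the first \<open>r\<close>
  places, where the weights are at least \<open>w r\<close>.\<close>

lemma weighted_sum_le_top:
  fixes w c :: "nat \<Rightarrow> real"
  assumes "r \<le> p" and w: "\<And>k. k < p \<Longrightarrow> 0 \<le> w k" "\<And>j k. k < p \<Longrightarrow> j \<le> k \<Longrightarrow> w k \<le> w j"
    and c: "\<And>k. k < p \<Longrightarrow> 0 \<le> c k" "\<And>k. k < p \<Longrightarrow> c k \<le> 1" "(\<Sum>k<p. c k) \<le> real r"
  shows "(\<Sum>k<p. w k * c k) \<le> (\<Sum>k<r. w k)"
proof (cases "r < p")
  \<comment> \<open>For \<open>r = p\<close> the pivot \<open>w r\<close> is not controlled by the
    assumptions, but then there is no tail.\<close>
  case False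
  then have "r = p" using assms(1) by simp
  then show ?thesis
    using w c by (auto intro!: sum_mono mult_left_le)
next
  case True
  have split: "(\<Sum>k<p. f k) = (\<Sum>k<r. f k) + (\<Sum>k=r..<p. f k)" for f :: "nat \<Rightarrow> real"
    using assms(1) by (metis atLeast0LessThan sum.atLeastLessThan_concat zero_le)
  have "(\<Sum>k=r..<p. w k * c k) \<le> (\<Sum>k=r..<p. w r * c k)"
    using w c by (intro sum_mono mult_right_mono) auto
  also have "\<dots> = w r * (\<Sum>k=r..<p. c k)"
    by (simp add: sum_distrib_left)
  also have "\<dots> \<le> w r * (\<Sum>k<r. 1 - c k)"
    using c(3) split[of c] w(1)[OF True] by (intro mult_left_mono) (auto simp: sum_subtractf)
  also have "\<dots> \<le> (\<Sum>k<r. w k * (1 - c k))"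
    unfolding sum_distrib_left using w(2) c(2) True by (intro sum_mono mult_right_mono) auto
  finally show ?thesis
    unfolding split[of "\<lambda>k. w k * c k"] by (simp add: algebra_simps sum_subtractf)
qed

text \<open>\<open>T\<close> captures no more of \<open>M\<close> than the projection onto the span
  of its left singular vectors \<open>q j\<close> does. That projection has energy
  \<open>\<Sum>k<p. (s k)\<^sup>2 * c k\<close> with weights in [0, 1] of total at most
  \<open>r\<close>, hence at most the \<open>r\<close> largest squares.\<close>

lemma eckart_young_lower_bound:
  fixes M T :: "real^'n^'m"
  assumes svd: "is_svd M s x y" and r: "r \<le> min CARD('m) CARD('n)" and rank: "rank T \<le> r"
  shows "(\<Sum>k=r..<min CARD('m) CARD('n). (s k)\<^sup>2) \<le> (norm (M - T))\<^sup>2"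
proof -
  define p where "p = min CARD('m) CARD('n)"
  have s: "\<And>k. k < p \<Longrightarrow> 0 \<le> s k" "\<And>j k. k < p \<Longrightarrow> j \<le> k \<Longrightarrow> s k \<le> s j"
    and ox: "orthonormal_upto p x" and oy: "orthonormal_upto p y"
    and M: "M = (\<Sum>k<p. s k *\<^sub>R outer (x k) (y k))"
    using svd by (auto simp: is_svd_iff p_def)
  obtain n t q z where svdT: "compact_svd n t q z T"
    using compact_svd_exists by blast
  have n: "n \<le> r"
    using compact_svd_rank[OF svdT] rank by simp
  have oq: "orthonormal_upto n q" and oz: "orthonormal_upto n z"
    and T: "T = (\<Sum>j<n. t j *\<^sub>R outer (q j) (z j))"
    using svdT by (auto simp: compact_svd_def)
  \<comment> \<open>\<open>c k\<close> is the squared length of the projection of \<open>x k\<close>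
    onto the span of the \<open>q j\<close>. Bessel for the \<open>q j\<close> bounds each
    \<open>c k\<close> by 1; Bessel for the \<open>x k\<close> bounds the total by
    \<open>n\<close>.\<close>
  define c where "c k = (\<Sum>j<n. (q j \<bullet> x k)\<^sup>2)" for k
  have c1: "c k \<le> 1" if "k < p" for k
    using bessel_upto[OF oq, of "x k"] ox that
    by (simp add: c_def orthonormal_upto_def power2_norm_eq_inner)
  have c0: "0 \<le> c k" for k
    by (simp add: c_def sum_nonneg)
  have "(\<Sum>k<p. c k) = (\<Sum>j<n. \<Sum>k<p. (x k \<bullet> q j)\<^sup>2)"
    unfolding c_def by (subst sum.swap) (simp add: inner_commute)
  also have "\<dots> \<le> (\<Sum>j<n. 1)"
    using bessel_upto[OF ox] oq
    by (intro sum_mono) (metis lessThan_iff orthonormal_upto_def power2_norm_eq_inner)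
  also have "\<dots> \<le> real r"
    using n by simp
  finally have csum: "(\<Sum>k<p. c k) \<le> real r" .
  have qM: "(norm (q j v* M))\<^sup>2 = (\<Sum>k<p. (s k)\<^sup>2 * (q j \<bullet> x k)\<^sup>2)" for j
    unfolding M using orthonormal_norm_sum[OF oy, of "\<lambda>k. s k * (x k \<bullet> q j)"]
    by (simp add: vec_mult_sum vec_mult_scaleR vec_mult_outer power_mult_distrib inner_commute)
  have MT: "M \<bullet> T = (\<Sum>j<n. t j * ((q j v* M) \<bullet> z j))"
    by (simp add: T inner_sum_right inner_outer inner_mult_vec)
  \<comment> \<open>Split along the singular triples of \<open>T\<close>; each summand is bounded by
    completing the square in \<open>t j\<close> with the unit vector \<open>z j\<close>.\<close>
  have "2 * (M \<bullet> T) - (norm T)\<^sup>2 = (\<Sum>j<n. 2 * (t j * ((q j v* M) \<bullet> z j)) - (t j)\<^sup>2)"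
    unfolding MT unfolding T norm_sum_outer[OF oq oz] by (simp add: sum_subtractf sum_distrib_left)
  also have "\<dots> \<le> (\<Sum>j<n. (norm (q j v* M))\<^sup>2)"
  proof (intro sum_mono)
    fix j assume "j \<in> {..<n}"
    then have "z j \<bullet> z j = 1" using oz by (simp add: orthonormal_upto_def)
    then have "(norm (q j v* M - t j *\<^sub>R z j))\<^sup>2 =
        (norm (q j v* M))\<^sup>2 - 2 * (t j * ((q j v* M) \<bullet> z j)) + (t j)\<^sup>2"
      by (simp add: norm_diff_square power_mult_distrib flip: power2_norm_eq_inner)
    then show "2 * (t j * ((q j v* M) \<bullet> z j)) - (t j)\<^sup>2 \<le> (norm (q j v* M))\<^sup>2"
      using zero_le_power2[of "norm (q j v* M - t j *\<^sub>R z j)"] by linarith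
  qed
  also have "\<dots> = (\<Sum>k<p. (s k)\<^sup>2 * c k)"
    unfolding qM c_def sum_distrib_left by (rule sum.swap)
  also have "\<dots> \<le> (\<Sum>k<r. (s k)\<^sup>2)"
    using r s c0 c1 csum by (intro weighted_sum_le_top) (auto simp: p_def intro!: power_mono)
  finally have "2 * (M \<bullet> T) - (norm T)\<^sup>2 \<le> (\<Sum>k<r. (s k)\<^sup>2)" .
  moreover have "(norm M)\<^sup>2 = (\<Sum>k<r. (s k)\<^sup>2) + (\<Sum>k=r..<p. (s k)\<^sup>2)"
    unfolding M norm_sum_outer[OF ox oy] using r
    by (metis atLeast0LessThan p_def sum.atLeastLessThan_concat zero_le)
  ultimately show ?thesis
    by (simp add: norm_diff_square p_def)
qed

lemma svd_truncation_outer: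
  "svd_truncation r M T \<longleftrightarrow> (\<exists>s x y. is_svd M s x y \<and> T = (\<Sum>k<r. s k *\<^sub>R outer (x k) (y k)))"
  by (simp add: svd_truncation_def outer_def)

lemma svd_truncation_error:
  fixes M T :: "real^'n^'m"
  assumes svd: "is_svd M s x y" and r: "r \<le> min CARD('m) CARD('n)"
    and T: "T = (\<Sum>k<r. s k *\<^sub>R outer (x k) (y k))"
  shows "(norm (M - T))\<^sup>2 = (\<Sum>k=r..<min CARD('m) CARD('n). (s k)\<^sup>2)"
proof -
  let ?p = "min CARD('m) CARD('n)"
  let ?u = "\<lambda>k. if k < r then 0 else s k"
  have ox: "orthonormal_upto ?p x" and oy: "orthonormal_upto ?p y"
    and M: "M = (\<Sum>k<?p. s k *\<^sub>R outer (x k) (y k))"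
    using svd by (auto simp: is_svd_iff)
  have split: "(\<Sum>k<?p. f k) = (\<Sum>k<r. f k) + (\<Sum>k=r..<?p. f k)" for f :: "nat \<Rightarrow> 'b::comm_monoid_add"
    using r by (metis atLeast0LessThan sum.atLeastLessThan_concat zero_le)
  have "M - T = (\<Sum>k<?p. ?u k *\<^sub>R outer (x k) (y k))"
    unfolding M T split by simp
  then have "(norm (M - T))\<^sup>2 = (\<Sum>k<?p. (?u k)\<^sup>2)"
    using norm_sum_outer[OF ox oy, of ?u] by simp
  then show ?thesis
    unfolding split by simp
qed

lemma rank_svd_truncation_le: "svd_truncation r M T \<Longrightarrow> rank T \<le> r"
  unfolding svd_truncation_outer outer_scaleR_left[symmetric] by (auto intro: rank_sum_outer_le)

lemma svd_truncation_optimal: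
  fixes M T T' :: "real^'n^'m"
  assumes "svd_truncation r M T" "r \<le> min CARD('m) CARD('n)" "rank T' \<le> r"
  shows "norm (M - T) \<le> norm (M - T')"
proof -
  obtain s x y where svd: "is_svd M s x y" "T = (\<Sum>k<r. s k *\<^sub>R outer (x k) (y k))"
    using assms(1) by (auto simp: svd_truncation_outer)
  have "(norm (M - T))\<^sup>2 \<le> (norm (M - T'))\<^sup>2"
    using svd_truncation_error[OF svd(1) assms(2) svd(2)]
      eckart_young_lower_bound[OF svd(1) assms(2,3)] by simp
  then show ?thesis
    by (rule power2_le_imp_le) simp
qed


lemma svd_truncation_exists: "\<exists>T. svd_truncation r M T"
  using svd_exists svd_truncation_outer by blast

section \<open>Every best approximation is a truncation\<close>

lemma norm_diff_outer:
  "(norm (N - outer a b))\<^sup>2 = (norm N)\<^sup>2 - 2 * (a \<bullet> (N *v b)) + (norm a)\<^sup>2 * (norm b)\<^sup>2"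
proof -
  have "(norm (outer a b))\<^sup>2 = (norm a)\<^sup>2 * (norm b)\<^sup>2"
    unfolding power2_norm_eq_inner by (simp add: inner_outer outer_mult_vec)
  then show ?thesis
    by (simp add: norm_diff_square inner_outer)
qed

text \<open>The residual \<open>N\<close> is tested against perturbations \<open>D\<close> that keep
  the rank of \<open>T + D\<close> at most \<open>r\<close>; none of them may decrease the error.
  Four choices of \<open>D\<close> give everything needed to merge the decompositions of
  \<open>T\<close> and \<open>N\<close>.\<close>

lemma low_rank_minimizer_is_truncation:
  fixes M T :: "real^'n^'m"
  assumes r: "0 < r" "r \<le> min CARD('m) CARD('n)" and rank: "rank T \<le> r"
    and opt: "\<And>T'. rank T' \<le> r \<Longrightarrow> norm (M - T) \<le> norm (M - T')"
  shows "svd_truncation r M T"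
proof -
  define N where "N = M - T"
  have opt2: "(norm N)\<^sup>2 \<le> (norm (N - D))\<^sup>2" if "rank (T + D) \<le> r" for D
    using opt[OF that] by (simp add: N_def diff_diff_add power_mono)
  obtain m t a b where svdT: "compact_svd m t a b T"
    using compact_svd_exists by blast
  obtain n s c d where svdN: "compact_svd n s c d N"
    using compact_svd_exists by blast
  have m: "m \<le> r"
    using compact_svd_rank[OF svdT] rank by simp
  have t: "\<And>k. k < m \<Longrightarrow> 0 < t k" "\<And>j k. k < m \<Longrightarrow> j \<le> k \<Longrightarrow> t k \<le> t j"
    and oa: "orthonormal_upto m a" and ob: "orthonormal_upto m b"
    and T: "T = (\<Sum>k<m. t k *\<^sub>R outer (a k) (b k))"
    using svdT by (auto simp: compact_svd_def)
  have s: "\<And>k. k < n \<Longrightarrow> 0 < s k" "\<And>j k. k < n \<Longrightarrow> j \<le> k \<Longrightarrow> s k \<le> s j"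
    and oc: "orthonormal_upto n c" and od: "orthonormal_upto n d"
    and N: "N = (\<Sum>k<n. s k *\<^sub>R outer (c k) (d k))"
    using svdN by (auto simp: compact_svd_def)
  have Nd: "N *v d k = s k *\<^sub>R c k" and cN: "c k v* N = s k *\<^sub>R d k" if "k < n" for k
    unfolding N using sum_outer_mult_vec[OF od that] vec_mult_sum_outer[OF oc that] by auto
  have na: "norm (a j) = 1" "norm (b j) = 1" if "j < m" for j
    using oa ob that by (auto simp: orthonormal_upto_def norm_eq_1)
  have nc: "norm (c k) = 1" "norm (d k) = 1" if "k < n" for k
    using oc od that by (auto simp: orthonormal_upto_def norm_eq_1)
  \<comment> \<open>Adding \<open>outer (a j) ?w\<close> changes only the \<open>j\<close>-th right
    factor of \<open>T\<close>, so there are still \<open>m\<close> rank-one terms, while the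
    squared error drops by exactly \<open>(norm ?w)\<^sup>2\<close>.\<close>
  have aN: "a j v* N = 0" if j: "j < m" for j
  proof -
    let ?w = "a j v* N"
    have "T + outer (a j) ?w = (\<Sum>k<m. outer (a k) (t k *\<^sub>R b k + (if k = j then ?w else 0)))"
      unfolding T outer_add_right sum.distrib using j
      by (simp add: outer_scaleR_right if_distrib[of "outer _"] cong: if_cong)
    then have "rank (T + outer (a j) ?w) \<le> m"
      by (simp only: rank_sum_outer_le)
    then have "rank (T + outer (a j) ?w) \<le> r"
      using m by simp
    then have "(norm N)\<^sup>2 \<le> (norm (N - outer (a j) ?w))\<^sup>2"
      by (rule opt2)
    then show ?thesis
      using na[OF j] unfolding norm_diff_outer inner_mult_vec by (simp flip: power2_norm_eq_inner)
  qed
  have Nb: "N *v b j = 0" if j: "j < m" for j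
  proof -
    let ?w = "N *v b j"
    have "T + outer ?w (b j) = (\<Sum>k<m. outer (t k *\<^sub>R a k + (if k = j then ?w else 0)) (b k))"
      unfolding T outer_add_left sum.distrib using j
      by (simp add: outer_scaleR_left if_distrib[of "\<lambda>z. outer z _"] cong: if_cong)
    then have "rank (T + outer ?w (b j)) \<le> m"
      by (simp only: rank_sum_outer_le)
    then have "rank (T + outer ?w (b j)) \<le> r"
      using m by simp
    then have "(norm N)\<^sup>2 \<le> (norm (N - outer ?w (b j)))\<^sup>2"
      by (rule opt2)
    then show ?thesis
      using na[OF j] unfolding norm_diff_outer by (simp flip: power2_norm_eq_inner)
  qed
  \<comment> \<open>The singular vectors of \<open>N\<close> with positive value lie in its range
    and row space, to which \<open>a j\<close> and \<open>b j\<close> are orthogonal.\<close>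
  have ac: "a j \<bullet> c k = 0" and bd: "b j \<bullet> d k = 0" if "j < m" "k < n" for j k
  proof -
    have "s k * (a j \<bullet> c k) = (a j v* N) \<bullet> d k"
      using that by (simp add: Nd flip: inner_mult_vec)
    then show "a j \<bullet> c k = 0" using aN that s(1) by fastforce
    have "s k * (b j \<bullet> d k) = (c k v* N) \<bullet> b j"
      using that by (simp add: cN inner_commute)
    then have "s k * (b j \<bullet> d k) = c k \<bullet> (N *v b j)"
      by (simp only: inner_mult_vec)
    then show "b j \<bullet> d k = 0" using Nb that s(1) by fastforce
  qed
  \<comment> \<open>If the rank is not exhausted, there is room for the top singular term of
    \<open>N\<close>, which would lower the squared error by \<open>(s 0)\<^sup>2\<close>.\<close>
  have n0: "n = 0" if "m < r"
  proof (rule ccontr)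
    assume "n \<noteq> 0"
    then have n: "0 < n" by simp
    have "T + outer (c 0) (s 0 *\<^sub>R d 0) =
        (\<Sum>k<Suc m. outer (if k < m then a k else c 0) (if k < m then t k *\<^sub>R b k else s 0 *\<^sub>R d 0))"
      by (simp add: T outer_scaleR_right)
    then have "rank (T + outer (c 0) (s 0 *\<^sub>R d 0)) \<le> Suc m"
      by (simp only: rank_sum_outer_le)
    then have "rank (T + outer (c 0) (s 0 *\<^sub>R d 0)) \<le> r"
      using that by simp
    then have "(norm N)\<^sup>2 \<le> (norm (N - outer (c 0) (s 0 *\<^sub>R d 0)))\<^sup>2"
      by (rule opt2)
    also have "\<dots> = (norm N)\<^sup>2 - (s 0)\<^sup>2"
      unfolding norm_diff_outer using nc[OF n] Nd[OF n]
      by (simp add: matrix_vector_mult_scaleR dot_square_norm power2_eq_square)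
    finally show False using s(1)[OF n] by simp
  qed
  \<comment> \<open>Exchange the smallest singular term of \<open>T\<close>, at index
    \<open>m - 1\<close>, for the largest of \<open>N\<close>. By orthogonality the squared error
    changes by exactly \<open>(t j)\<^sup>2 - (s 0)\<^sup>2\<close>.\<close>
  have s_le: "s 0 \<le> t (m - 1)" if "m = r" "0 < n"
  proof -
    define j where "j = m - 1"
    have j: "j < m" and mj: "m = Suc j" using that r by (simp_all add: j_def)
    let ?D = "outer (c 0) (s 0 *\<^sub>R d 0) - outer (a j) (t j *\<^sub>R b j)"
    have "T + ?D = T - t j *\<^sub>R outer (a j) (b j) + outer (c 0) (s 0 *\<^sub>R d 0)"
      by (simp add: outer_scaleR_right)
    also have "T - t j *\<^sub>R outer (a j) (b j) = (\<Sum>k<j. outer (a k) (t k *\<^sub>R b k))"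
      unfolding T mj sum.lessThan_Suc by (simp add: outer_scaleR_right)
    also have "\<dots> + outer (c 0) (s 0 *\<^sub>R d 0) =
        (\<Sum>k<Suc j. outer (if k < j then a k else c 0) (if k < j then t k *\<^sub>R b k else s 0 *\<^sub>R d 0))"
      by simp
    finally have "rank (T + ?D) \<le> Suc j"
      by (simp only: rank_sum_outer_le)
    then have "rank (T + ?D) \<le> r"
      using j m by simp
    then have "(norm N)\<^sup>2 \<le> (norm (N - ?D))\<^sup>2"
      by (rule opt2)
    also have "N - ?D = (N + outer (a j) (t j *\<^sub>R b j)) - outer (c 0) (s 0 *\<^sub>R d 0)"
      by simp
    also have "(norm \<dots>)\<^sup>2 = (norm (N + outer (a j) (t j *\<^sub>R b j)))\<^sup>2 - (s 0)\<^sup>2"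
      unfolding norm_diff_outer using nc[OF that(2)] Nd[OF that(2)] ac[OF j that(2)]
      by (simp add: matrix_vector_mult_scaleR matrix_vector_mult_add_rdistrib outer_mult_vec
          inner_add_right inner_commute dot_square_norm power2_eq_square)
    also have "N + outer (a j) (t j *\<^sub>R b j) = N - outer (a j) ((- t j) *\<^sub>R b j)"
      unfolding outer_scaleR_right by simp
    also have "(norm \<dots>)\<^sup>2 = (norm N)\<^sup>2 + (t j)\<^sup>2"
      unfolding norm_diff_outer using na[OF j] Nb[OF j]
      by (simp add: matrix_vector_mult_scaleR linear_neg[OF matrix_vector_mul_linear])
    finally have "(s 0)\<^sup>2 \<le> (t j)\<^sup>2" by simp
    then show ?thesis
      using t(1)[OF j] unfolding j_def by (rule power2_le_imp_le[OF _ less_imp_le])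
  qed
  let ?s = "\<lambda>k. if k < m then t k else s (k - m)"
  let ?x = "\<lambda>k. if k < m then a k else c (k - m)"
  let ?y = "\<lambda>k. if k < m then b k else d (k - m)"
  have "compact_svd (m + n) ?s ?x ?y M"
    unfolding compact_svd_def
  proof (intro conjI)
    show "\<forall>k<m + n. 0 < ?s k"
      using t(1) s(1) by auto
    have "s k \<le> t j" if "k < n" "j < m" for j k
    proof -
      have "s k \<le> s 0" using s(2) that by simp
      \<comment> \<open>\<open>N\<close> has a singular value here, so \<open>n0\<close> forces
        \<open>m = r\<close> and the exchange bound applies.\<close>
      also have "s 0 \<le> t (m - 1)" using s_le n0 m that by linarith
      also have "\<dots> \<le> t j" using t(2) that by simp
      finally show ?thesis .
    qed
    then show "\<forall>k<m + n. \<forall>j\<le>k. ?s k \<le> ?s j"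
      using t(2) s(2) by auto
    show "orthonormal_upto (m + n) ?x" "orthonormal_upto (m + n) ?y"
      using oa ob oc od ac bd by (auto intro: orthonormal_upto_append)
    have "(\<Sum>k<m + n. ?s k *\<^sub>R outer (?x k) (?y k)) = T + N"
      unfolding sum_lessThan_add T N by simp
    then show "M = (\<Sum>k<m + n. ?s k *\<^sub>R outer (?x k) (?y k))"
      by (simp add: N_def)
  qed
  then obtain x' y' where svd: "is_svd M (\<lambda>k. if k < m + n then ?s k else 0) x' y'"
    and x'y': "\<forall>k<m + n. x' k = ?x k \<and> y' k = ?y k"
    using compact_svd_extend by blast
  \<comment> \<open>The terms with \<open>m \<le> k < r\<close> vanish: they occur only if
    \<open>m < r\<close>, and then \<open>n = 0\<close>.\<close>
  have "(\<Sum>k<r. (if k < m + n then ?s k else 0) *\<^sub>R outer (x' k) (y' k)) =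
      (\<Sum>k<m. (if k < m + n then ?s k else 0) *\<^sub>R outer (x' k) (y' k))"
    using m n0 by (intro sum.mono_neutral_right) auto
  also have "\<dots> = T"
    unfolding T using x'y' by (intro sum.cong) auto
  finally have "T = (\<Sum>k<r. (if k < m + n then ?s k else 0) *\<^sub>R outer (x' k) (y' k))" ..
  with svd show ?thesis
    unfolding svd_truncation_outer by (intro exI conjI)
qed

section \<open>Square roots of positive-definite matrices\<close>

definition diag_mat :: "('n \<Rightarrow> real) \<Rightarrow> real^'n^'n" where
  "diag_mat d = (\<chi> i j. if i = j then d i else 0)"

lemma diag_mat_mult: "diag_mat d ** diag_mat e = diag_mat (\<lambda>i. d i * e i)"
  by (simp add: diag_mat_def matrix_matrix_mult_def vec_eq_iff if_distrib[of "\<lambda>x. x * _"] cong: if_cong)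

lemma diag_mat_mult_vec: "(diag_mat d *v z) $ i = d i * z $ i"
  by (simp add: diag_mat_def matrix_vector_mult_def if_distrib[of "\<lambda>x. x * _"] cong: if_cong)

lemma transpose_diag_mat [simp]: "transpose (diag_mat d) = diag_mat d"
  by (simp add: diag_mat_def transpose_def vec_eq_iff)

lemma diag_mat_1: "diag_mat (\<lambda>_. 1) = mat 1"
  by (simp add: diag_mat_def mat_def)

lemma inner_diag_mat: "z \<bullet> (diag_mat d *v z) = (\<Sum>i\<in>UNIV. d i * (z $ i)\<^sup>2)"
  by (simp add: inner_vec_def diag_mat_mult_vec power2_eq_square mult_ac)

lemma det_diag_mat: "det (diag_mat d) = (\<Prod>i\<in>UNIV. d i)"
  by (subst det_diagonal) (simp_all add: diag_mat_def)

lemma pos_def_transpose: "pos_def C \<Longrightarrow> transpose C = C"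
  by (simp add: pos_def_def)

lemma pos_def_vec_mult: "pos_def C \<Longrightarrow> z v* C = C *v z"
  by (metis pos_def_def transpose_matrix_vector)

lemma pos_def_invertible:
  assumes "pos_def C"
  shows "invertible C"
proof -
  have "x = 0" if "C *v x = 0" for x
    using assms that by (metis inner_zero_right less_irrefl pos_def_def)
  then show ?thesis
    unfolding invertible_left_inverse matrix_left_invertible_ker by blast
qed

lemma matrix_inv_mult:
  fixes C :: "real^'n^'n"
  assumes "invertible C"
  shows "matrix_inv C ** C = mat 1" "C ** matrix_inv C = mat 1"
proof -
  have "\<exists>B. C ** B = mat 1 \<and> B ** C = mat 1"
    using assms by (simp add: invertible_def)
  from someI_ex[OF this] show "matrix_inv C ** C = mat 1" "C ** matrix_inv C = mat 1"
    unfolding matrix_inv_def by blast+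
qed

lemma matrix_inv_eqI:
  fixes C D :: "real^'n^'n"
  assumes "C ** D = mat 1"
  shows "matrix_inv C = D"
proof -
  have "invertible C"
    using assms invertible_right_inverse by blast
  have "matrix_inv C = matrix_inv C ** (C ** D)"
    by (simp add: assms)
  also have "\<dots> = D"
    unfolding matrix_mul_assoc by (simp add: matrix_inv_mult \<open>invertible C\<close>)
  finally show ?thesis .
qed

lemma orthogonal_conj_mult:
  fixes Q A B :: "real^'n^'n"
  assumes "orthogonal_matrix Q"
  shows "(Q ** A ** transpose Q) ** (Q ** B ** transpose Q) = Q ** (A ** B) ** transpose Q"
proof -
  have "(Q ** A ** transpose Q) ** (Q ** B ** transpose Q) =
      Q ** A ** (transpose Q ** Q) ** B ** transpose Q"
    by (simp only: matrix_mul_assoc)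
  also have "transpose Q ** Q = mat 1"
    using assms by (simp add: orthogonal_matrix)
  finally show ?thesis
    by (simp add: matrix_mul_assoc)
qed

lemma inner_matrix_transpose: "(A *v x) \<bullet> y = x \<bullet> (transpose A *v y)" for A :: "real^'n^'m"
  by (metis dot_lmul_matrix inner_commute transpose_matrix_vector)

lemma pos_def_orthogonal_diag:
  fixes Q :: "real^'n^'n"
  assumes Q: "orthogonal_matrix Q" and d: "\<And>i. 0 < d i"
  shows "pos_def (Q ** diag_mat d ** transpose Q)"
  unfolding pos_def_def
proof (intro conjI allI impI)
  show "transpose (Q ** diag_mat d ** transpose Q) = Q ** diag_mat d ** transpose Q"
    by (simp add: matrix_transpose_mul matrix_mul_assoc)
  fix x :: "real^'n" assume "x \<noteq> 0"
  let ?w = "transpose Q *v x"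
  have "Q *v ?w = x"
    using Q by (metis matrix_vector_mul_assoc matrix_vector_mul_lid orthogonal_matrix_def)
  then have "?w \<noteq> 0"
    using \<open>x \<noteq> 0\<close> by (metis matrix_vector_mult_0_right)
  then obtain i where i: "?w $ i \<noteq> 0"
    by (auto simp only: vec_eq_iff zero_index)
  have "x \<bullet> ((Q ** diag_mat d ** transpose Q) *v x) = ?w \<bullet> (diag_mat d *v ?w)"
    using inner_matrix_transpose[of "transpose Q" x]
    by (simp only: matrix_vector_mul_assoc[symmetric] transpose_transpose)
  also have "\<dots> = (\<Sum>i\<in>UNIV. d i * (?w $ i)\<^sup>2)"
    by (rule inner_diag_mat)
  also have "\<dots> > 0"
    using i d by (intro sum_pos2[of _ i]) (simp_all add: less_imp_le del: transpose_matrix_vector)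
  finally show "0 < x \<bullet> ((Q ** diag_mat d ** transpose Q) *v x)" .
qed

text \<open>For symmetric positive-definite \<open>C\<close>, a singular pair \<open>(x, y)\<close> with value \<open>\<sigma>\<close> gives
  \<open>C (x - y) = - \<sigma> (x - y)\<close>, so that \<open>x = y\<close>.\<close>

lemma pos_def_spectral:
  fixes C :: "real^'n^'n"
  assumes C: "pos_def C"
  obtains Q d where "orthogonal_matrix Q" "\<And>i. 0 < d i" "C = Q ** diag_mat d ** transpose Q"
proof -
  obtain s x y where "is_svd C s x y"
    using svd_exists by blast
  then have s: "\<And>k. k < CARD('n) \<Longrightarrow> 0 \<le> s k"
    and ox: "orthonormal_upto CARD('n) x" and oy: "orthonormal_upto CARD('n) y"
    and Ceq: "C = (\<Sum>k<CARD('n). s k *\<^sub>R outer (x k) (y k))"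
    by (auto simp: is_svd_iff)
  have xy: "x k = y k" and s_pos: "0 < s k" if k: "k < CARD('n)" for k
  proof -
    have Cy: "C *v y k = s k *\<^sub>R x k"
      unfolding Ceq by (rule sum_outer_mult_vec[OF oy k])
    have "x k v* C = s k *\<^sub>R y k"
      unfolding Ceq by (rule vec_mult_sum_outer[OF ox k])
    then have Cx: "C *v x k = s k *\<^sub>R y k"
      by (simp add: pos_def_vec_mult[OF C])
    have "y k \<noteq> 0"
      using oy k by (force simp: orthonormal_upto_def)
    then have "C *v y k \<noteq> 0"
      using C by (metis inner_zero_right less_irrefl pos_def_def)
    then show "0 < s k"
      using Cy s[OF k] by (cases "s k = 0") auto
    have "C *v (x k - y k) = - s k *\<^sub>R (x k - y k)"
      by (simp add: matrix_vector_mult_diff_distrib Cx Cy algebra_simps)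
    then have "(x k - y k) \<bullet> (C *v (x k - y k)) \<le> 0"
      using s[OF k] by simp
    then show "x k = y k"
      using C by (metis eq_iff_diff_eq_0 not_less pos_def_def)
  qed
  \<comment> \<open>\<open>h\<close> enumerates the index type, so that the vectors
    \<open>x k\<close>, numbered by naturals, become the columns of \<open>Q\<close>.\<close>
  obtain h where h: "bij_betw h (UNIV :: 'n set) {..<CARD('n)}"
    using ex_bij_betw_finite_nat[of "UNIV :: 'n set"] by (auto simp: atLeast0LessThan)
  then have h_less: "h i < CARD('n)" and h_inj: "h i = h j \<longleftrightarrow> i = j" for i j
    by (auto simp: bij_betw_def inj_eq)
  define Q :: "real^'n^'n" where "Q = (\<chi> i j. x (h j) $ i)"
  have "(transpose Q ** Q) $ i $ j = mat 1 $ i $ j" for i j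
  proof -
    have "(transpose Q ** Q) $ i $ j = x (h i) \<bullet> x (h j)"
      by (simp add: Q_def transpose_def matrix_matrix_mult_def inner_vec_def)
    then show ?thesis
      using ox h_less h_inj by (simp add: orthonormal_upto_def mat_def)
  qed
  then have "orthogonal_matrix Q"
    by (simp add: orthogonal_matrix vec_eq_iff)
  moreover have "C = Q ** diag_mat (\<lambda>i. s (h i)) ** transpose Q"
  proof -
    have "C $ i $ j = (Q ** diag_mat (\<lambda>i. s (h i)) ** transpose Q) $ i $ j" for i j
    proof -
      have "C $ i $ j = (\<Sum>k<CARD('n). s k * (x k $ i * x k $ j))"
        using xy by (simp add: Ceq outer_def)
      also have "\<dots> = (\<Sum>l\<in>UNIV. s (h l) * (x (h l) $ i * x (h l) $ j))"
        by (rule sum.reindex_bij_betw[OF h, symmetric])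
      also have "\<dots> = (Q ** diag_mat (\<lambda>i. s (h i)) ** transpose Q) $ i $ j"
        by (simp add: Q_def diag_mat_def transpose_def matrix_matrix_mult_def if_distrib mult_ac
            cong: if_cong)
      finally show ?thesis .
    qed
    then show ?thesis by (simp add: vec_eq_iff)
  qed
  ultimately show ?thesis
    using that[of Q "\<lambda>i. s (h i)"] s_pos h_less by simp
qed

lemma det_orthogonal_conj:
  fixes A :: "real^'n^'n"
  assumes "orthogonal_matrix Q"
  shows "det (Q ** A ** transpose Q) = det A"
  using det_orthogonal_matrix[OF assms] by (auto simp: det_mul det_transpose)

lemma pos_def_det_pos:
  assumes "pos_def C"
  shows "0 < det C"
proof -
  obtain Q d where "orthogonal_matrix Q" "\<And>i. 0 < d i" "C = Q ** diag_mat d ** transpose Q"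
    using pos_def_spectral[OF assms] by blast
  then show ?thesis
    by (simp add: det_orthogonal_conj det_diag_mat prod_pos)
qed

lemma pos_def_sqrt_exists:
  assumes "pos_def C"
  shows "\<exists>S. pos_def S \<and> S ** S = C"
proof -
  obtain Q d where Q: "orthogonal_matrix Q" and d: "\<And>i. 0 < d i"
    and C: "C = Q ** diag_mat d ** transpose Q"
    using pos_def_spectral[OF assms] by blast
  let ?S = "Q ** diag_mat (\<lambda>i. sqrt (d i)) ** transpose Q"
  have "?S ** ?S = C"
    using d by (simp add: C orthogonal_conj_mult[OF Q] diag_mat_mult less_imp_le)
  moreover have "pos_def ?S"
    using d by (intro pos_def_orthogonal_diag Q) simp
  ultimately show ?thesis by blast
qed

text \<open>For square roots \<open>S\<close>, \<open>S'\<close> of the same matrix, \<open>D = S - S'\<close> satisfies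
  \<open>S D + D S' = 0\<close>; testing this on an eigenvector of \<open>D\<close> shows that all eigenvalues of \<open>D\<close> vanish.\<close>

lemma pos_def_sqrt_unique:
  fixes S S' :: "real^'n^'n"
  assumes S: "pos_def S" and S': "pos_def S'" and eq: "S ** S = S' ** S'"
  shows "S = S'"
proof (rule ccontr)
  assume "S \<noteq> S'"
  define D where "D = S - S'"
  have "D \<noteq> 0" using \<open>S \<noteq> S'\<close> by (simp add: D_def)
  then obtain \<sigma> a b where \<sigma>: "0 < \<sigma>" and ab: "norm a = 1" "norm b = 1"
    and Db: "D *v b = \<sigma> *\<^sub>R a" and Da: "a v* D = \<sigma> *\<^sub>R b"
    by (rule top_singular_pair) (use that in blast)
  have vD: "z v* D = D *v z" for z
    by (simp add: D_def vector_matrix_mult_diff_rdistrib matrix_vector_mult_diff_rdistrib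
        pos_def_vec_mult S S')
  \<comment> \<open>The symmetric \<open>D\<close> maps \<open>a\<close> to
    \<open>\<sigma> *\<^sub>R b\<close> and \<open>b\<close> to \<open>\<sigma> *\<^sub>R a\<close>,
    so \<open>a + b\<close> is an eigenvector for \<open>\<sigma>\<close> unless it vanishes, in
    which case \<open>a - b\<close> is one for \<open>- \<sigma>\<close>.\<close>
  obtain e \<mu> where e: "e \<noteq> 0" "\<mu> \<noteq> 0" "D *v e = \<mu> *\<^sub>R e"
  proof (cases "a + b = 0")
    case True
    then have "b = - a"
      by (simp add: eq_neg_iff_add_eq_0 add.commute)
    then have "a - b = 2 *\<^sub>R a"
      by (simp add: scaleR_2)
    then have "a - b \<noteq> 0"
      using ab by auto
    moreover have "D *v (a - b) = - \<sigma> *\<^sub>R (a - b)"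
      using Db Da by (simp add: vD matrix_vector_mult_diff_distrib algebra_simps)
    ultimately show ?thesis using that[of "a - b" "- \<sigma>"] \<sigma> by simp
  next
    case False
    moreover have "D *v (a + b) = \<sigma> *\<^sub>R (a + b)"
      using Db Da by (simp add: vD matrix_vector_right_distrib algebra_simps)
    ultimately show ?thesis using that[of "a + b" \<sigma>] \<sigma> by simp
  qed
  have "S *v (S *v e) = S' *v (S' *v e)"
    by (simp only: matrix_vector_mul_assoc eq)
  then have "S *v (D *v e) + D *v (S' *v e) = 0"
    by (simp add: D_def matrix_vector_mult_diff_rdistrib matrix_vector_mult_diff_distrib)
  then have "0 = e \<bullet> (S *v (D *v e)) + e \<bullet> (D *v (S' *v e))"
    by (metis inner_add_right inner_zero_right)
  also have "e \<bullet> (D *v (S' *v e)) = (D *v e) \<bullet> (S' *v e)"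
    by (simp only: inner_mult_vec vD)
  finally have "\<mu> * (e \<bullet> (S *v e) + e \<bullet> (S' *v e)) = 0"
    by (simp add: e(3) matrix_vector_mult_scaleR algebra_simps)
  moreover have "0 < e \<bullet> (S *v e)" "0 < e \<bullet> (S' *v e)"
    using S S' e(1) by (auto simp: pos_def_def)
  ultimately show False
    using e(2) by simp
qed

lemma pos_def_msqrt: "pos_def C \<Longrightarrow> pos_def (msqrt C)"
  and msqrt_mult_msqrt: "pos_def C \<Longrightarrow> msqrt C ** msqrt C = C"
proof -
  assume C: "pos_def C"
  have "\<exists>!S. pos_def S \<and> S ** S = C"
    using pos_def_sqrt_exists[OF C] pos_def_sqrt_unique by metis
  from theI'[OF this] show "pos_def (msqrt C)" "msqrt C ** msqrt C = C"
    unfolding msqrt_def by auto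
qed

section \<open>Gaussian integrals\<close>

lemma nn_integral_lborel_translate:
  fixes g :: "'a::euclidean_space \<Rightarrow> ennreal"
  assumes [measurable]: "g \<in> borel_measurable borel"
  shows "(\<integral>\<^sup>+x. g (c + x) \<partial>lborel) = (\<integral>\<^sup>+x. g x \<partial>lborel)"
proof -
  have "(\<integral>\<^sup>+x. g x \<partial>lborel) = (\<integral>\<^sup>+x. g x \<partial>distr lborel borel ((+) c))"
    by (simp only: lborel_distr_plus)
  then show ?thesis
    by (simp add: nn_integral_distr)
qed

lemma nn_integral_lborel_reflect:
  fixes g :: "'a::euclidean_space \<Rightarrow> ennreal"
  assumes [measurable]: "g \<in> borel_measurable borel"
  shows "(\<integral>\<^sup>+x. g (c - x) \<partial>lborel) = (\<integral>\<^sup>+x. g x \<partial>lborel)"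
proof -
  have "(\<integral>\<^sup>+x. g x \<partial>lborel) =
      (\<integral>\<^sup>+x. g x \<partial>density (distr lborel borel (\<lambda>x. c + (-1) *\<^sub>R x)) (\<lambda>_. 1))"
    using lborel_affine[of "-1" c] by simp
  then show ?thesis
    by (simp add: density_1 nn_integral_distr)
qed

text \<open>The uniqueness argument for Haar measures: integrate \<open>g (f x + y) * h y\<close> over \<open>x\<close> and \<open>y\<close> in
  both orders, where \<open>h\<close> is the indicator of the unit ball, which \<open>f\<close> preserves. The library's
  linear change of variables does not apply, since it needs a well-ordered index type.\<close>

lemma nn_integral_lborel_isometry:
  fixes f f' :: "'a::euclidean_space \<Rightarrow> 'a" and g :: "'a \<Rightarrow> ennreal"
  assumes [measurable]: "g \<in> borel_measurable borel" "f \<in> borel_measurable borel"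
    and add: "\<And>x y. f (x + y) = f x + f y" and norm: "\<And>x. norm (f x) = norm x"
    and inv: "\<And>y. f (f' y) = y"
  shows "(\<integral>\<^sup>+x. g (f x) \<partial>lborel) = (\<integral>\<^sup>+x. g x \<partial>lborel)"
proof -
  define h :: "'a \<Rightarrow> ennreal" where "h = indicator (ball 0 1)"
  have [measurable]: "h \<in> borel_measurable borel"
    unfolding h_def by (intro borel_measurable_indicator) simp
  have h_norm: "h x = h y" if "norm x = norm y" for x y
    using that by (simp add: h_def indicator_def)
  define H where "H = (\<integral>\<^sup>+x. h x \<partial>lborel)"
  \<comment> \<open>\<open>H\<close> is the volume of the unit ball; being positive and finite, it
    can be cancelled at the end.\<close>
  have "unit_ball_vol (real DIM('a)) > 0"
    by simp
  then have H: "H \<noteq> 0" "H \<noteq> \<infinity>"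
    by (simp_all add: H_def h_def emeasure_ball del: unit_ball_vol_pos)
  have shift: "(\<integral>\<^sup>+x. g (f x) \<partial>lborel) = (\<integral>\<^sup>+x. g (f x + y) \<partial>lborel)" for y
    using nn_integral_lborel_translate[of "\<lambda>x. g (f x)" "f' y"] by (simp add: add inv add.commute)
  \<comment> \<open>Pulling \<open>f\<close> out lets norm preservation remove it inside
    \<open>h\<close>; a reflection then shows that the integral over \<open>x\<close> is
    \<open>H\<close>.\<close>
  have diff: "y - f x = f (f' y - x)" for x y
    using add[of "f' y - x" x] by (simp add: inv algebra_simps)
  have "(\<integral>\<^sup>+x. g (f x) \<partial>lborel) * H = (\<integral>\<^sup>+y. (\<integral>\<^sup>+x. g (f x) \<partial>lborel) * h y \<partial>lborel)"
    by (simp add: H_def nn_integral_cmult)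
  also have "\<dots> = (\<integral>\<^sup>+y. (\<integral>\<^sup>+x. g (f x + y) * h y \<partial>lborel) \<partial>lborel)"
    by (intro nn_integral_cong) (subst shift, simp add: nn_integral_multc)
  also have "\<dots> = (\<integral>\<^sup>+x. (\<integral>\<^sup>+y. g (f x + y) * h y \<partial>lborel) \<partial>lborel)"
    by (rule lborel_pair.Fubini') measurable
  also have "\<dots> = (\<integral>\<^sup>+x. (\<integral>\<^sup>+y. g y * h (y - f x) \<partial>lborel) \<partial>lborel)"
  proof (rule nn_integral_cong)
    fix x
    show "(\<integral>\<^sup>+y. g (f x + y) * h y \<partial>lborel) = (\<integral>\<^sup>+y. g y * h (y - f x) \<partial>lborel)"
      using nn_integral_lborel_translate[of "\<lambda>y. g y * h (y - f x)" "f x"] by simp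
  qed
  also have "\<dots> = (\<integral>\<^sup>+y. (\<integral>\<^sup>+x. g y * h (y - f x) \<partial>lborel) \<partial>lborel)"
    by (rule lborel_pair.Fubini'[symmetric]) measurable
  also have "\<dots> = (\<integral>\<^sup>+y. g y * H \<partial>lborel)"
  proof (rule nn_integral_cong)
    fix y
    have "(\<integral>\<^sup>+x. g y * h (y - f x) \<partial>lborel) = g y * (\<integral>\<^sup>+x. h (y - f x) \<partial>lborel)"
      by (simp add: nn_integral_cmult)
    also have "(\<integral>\<^sup>+x. h (y - f x) \<partial>lborel) = (\<integral>\<^sup>+x. h (f' y - x) \<partial>lborel)"
      unfolding diff by (intro nn_integral_cong h_norm norm)
    also have "\<dots> = H"
      by (simp add: nn_integral_lborel_reflect H_def)
    finally show "(\<integral>\<^sup>+x. g y * h (y - f x) \<partial>lborel) = g y * H" .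
  qed
  also have "\<dots> = (\<integral>\<^sup>+y. g y \<partial>lborel) * H"
    by (simp add: nn_integral_multc)
  finally show ?thesis
    using H by (metis ennreal_mult_cancel_left infinity_ennreal_def mult.commute)
qed

section \<open>The normalising constant\<close>

lemma real_sqrt_prod: "sqrt (\<Prod>i\<in>I. f i) = (\<Prod>i\<in>I. sqrt (f i))"
  by (induction I rule: infinite_finite_induct) (simp_all add: real_sqrt_mult)

lemma Basis_vec_real: "(Basis :: (real^'n) set) = range (\<lambda>i. axis i 1)"
  by (auto simp: Basis_vec_def)

lemma nn_integral_lborel_vec_prod:
  fixes f :: "'n::finite \<Rightarrow> real \<Rightarrow> ennreal"
  assumes [measurable]: "\<And>i. f i \<in> borel_measurable borel"
  shows "(\<integral>\<^sup>+x. (\<Prod>i\<in>UNIV. f i (x $ i)) \<partial>lborel) = (\<Prod>i\<in>UNIV. (\<integral>\<^sup>+t. f i t \<partial>lborel))"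
proof -
  have inj: "inj (\<lambda>i::'n. axis i (1::real))"
    by (simp add: inj_on_def axis_eq_axis)
  \<comment> \<open>\<open>F\<close> carries the factors from coordinates over to the standard basis
    vectors \<open>axis i 1\<close>.\<close>
  define F :: "real^'n \<Rightarrow> real \<Rightarrow> ennreal" where "F b = f (inv (\<lambda>i. axis i 1) b)" for b
  have F: "F (axis i 1) = f i" for i
    by (simp add: F_def inv_f_f[OF inj])
  have "(\<integral>\<^sup>+x. (\<Prod>b\<in>Basis. F b (x \<bullet> b)) \<partial>lborel) = (\<Prod>b\<in>Basis. (\<integral>\<^sup>+t. F b t \<partial>lborel))"
    by (rule nn_integral_lborel_prod) (simp_all add: F_def)
  then show ?thesis
    unfolding Basis_vec_real by (simp add: prod.reindex[OF inj] F inner_axis)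
qed

lemma nn_integral_gaussian_1d:
  assumes "0 < d"
  shows "(\<integral>\<^sup>+t. ennreal (exp (- t\<^sup>2 / (2 * d))) \<partial>lborel) = ennreal (sqrt (2 * pi * d))"
proof -
  have eq: "exp (- t\<^sup>2 / (2 * d)) = sqrt (2 * pi * d) * normal_density 0 (sqrt d) t" for t
    using assms by (simp add: normal_density_def)
  have "(\<integral>\<^sup>+t. ennreal (normal_density 0 (sqrt d) t) \<partial>lborel) = 1"
    using assms by (simp add: nn_integral_eq_integral)
  then show ?thesis
    using assms unfolding eq by (simp add: ennreal_mult' nn_integral_cmult)
qed

lemma borel_measurable_quadratic [measurable]:
  "(\<lambda>x::real^'n. x \<bullet> (P *v x)) \<in> borel_measurable borel"
  by (intro borel_measurable_continuous_onI continuous_intros)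

lemma pos_def_inv_orthogonal_diag:
  fixes Q :: "real^'n^'n"
  assumes Q: "orthogonal_matrix Q" and d: "\<And>i. 0 < d i"
  shows "matrix_inv (Q ** diag_mat d ** transpose Q) = Q ** diag_mat (\<lambda>i. 1 / d i) ** transpose Q"
proof (rule matrix_inv_eqI)
  have "d i * (1 / d i) = 1" for i
    using d[of i] by simp
  then show "(Q ** diag_mat d ** transpose Q) ** (Q ** diag_mat (\<lambda>i. 1 / d i) ** transpose Q) = mat 1"
    using Q by (simp add: orthogonal_conj_mult[OF Q] diag_mat_mult diag_mat_1 orthogonal_matrix_def)
qed

text \<open>Rotating by the orthogonal \<open>Q\<close> of the spectral decomposition splits the
  integrand into one-dimensional Gaussians whose variances \<open>d i\<close> multiply to
  \<open>det C\<close>.\<close>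

lemma nn_integral_exp_quadratic:
  fixes C :: "real^'n^'n"
  assumes C: "pos_def C"
  shows "(\<integral>\<^sup>+x. ennreal (exp (- (x \<bullet> (matrix_inv C *v x)) / 2)) \<partial>lborel) =
    ennreal (sqrt ((2 * pi) ^ CARD('n) * det C))"
proof -
  obtain Q d where Q: "orthogonal_matrix Q" and d: "\<And>i. 0 < d i"
    and Ceq: "C = Q ** diag_mat d ** transpose Q"
    using pos_def_spectral[OF C] by blast
  have QQ: "transpose Q ** Q = mat 1" "Q ** transpose Q = mat 1"
    using Q by (simp_all add: orthogonal_matrix_def)
  let ?g = "\<lambda>x. ennreal (exp (- (x \<bullet> (matrix_inv C *v x)) / 2))"
  have quad: "(Q *v z) \<bullet> (matrix_inv C *v (Q *v z)) = (\<Sum>i\<in>UNIV. (z $ i)\<^sup>2 / d i)" for z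
  proof -
    have "matrix_inv C *v (Q *v z) = Q *v (diag_mat (\<lambda>i. 1 / d i) *v ((transpose Q ** Q) *v z))"
      unfolding Ceq pos_def_inv_orthogonal_diag[OF Q d] by (simp only: matrix_vector_mul_assoc matrix_mul_assoc)
    then have "(Q *v z) \<bullet> (matrix_inv C *v (Q *v z)) =
        z \<bullet> ((transpose Q ** Q) *v (diag_mat (\<lambda>i. 1 / d i) *v z))"
      unfolding inner_matrix_transpose by (simp only: QQ matrix_vector_mul_lid matrix_vector_mul_assoc matrix_mul_assoc matrix_mul_lid)
    then show ?thesis
      by (simp add: QQ inner_diag_mat)
  qed
  have norm: "norm (Q *v z) = norm z" for z
    by (simp only: norm_eq_sqrt_inner inner_matrix_transpose matrix_vector_mul_assoc QQ
        matrix_vector_mul_lid)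
  have "(\<integral>\<^sup>+x. ?g x \<partial>lborel) = (\<integral>\<^sup>+z. ?g (Q *v z) \<partial>lborel)"
    by (rule nn_integral_lborel_isometry[where f' = "(*v) (transpose Q)", symmetric])
      (simp_all add: matrix_vector_right_distrib norm matrix_vector_mul_assoc QQ
        borel_measurable_continuous_onI matrix_vector_mult_linear_continuous_on
        del: transpose_matrix_vector)
  also have "\<dots> = (\<integral>\<^sup>+z. (\<Prod>i\<in>UNIV. ennreal (exp (- (z $ i)\<^sup>2 / (2 * d i)))) \<partial>lborel)"
  proof (rule nn_integral_cong)
    fix z
    have "- (\<Sum>i\<in>UNIV. (z $ i)\<^sup>2 / d i) / 2 = (\<Sum>i\<in>UNIV. - (z $ i)\<^sup>2 / (2 * d i))"
      by (simp add: sum_divide_distrib sum_negf mult.commute)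
    then show "?g (Q *v z) = (\<Prod>i\<in>UNIV. ennreal (exp (- (z $ i)\<^sup>2 / (2 * d i))))"
      unfolding quad by (simp add: exp_sum prod_ennreal)
  qed
  also have "\<dots> = (\<Prod>i\<in>UNIV. (\<integral>\<^sup>+t. ennreal (exp (- t\<^sup>2 / (2 * d i))) \<partial>lborel))"
    by (rule nn_integral_lborel_vec_prod) measurable
  also have "\<dots> = (\<Prod>i\<in>UNIV. ennreal (sqrt (2 * pi * d i)))"
    by (simp only: nn_integral_gaussian_1d d)
  also have "\<dots> = ennreal (\<Prod>i\<in>UNIV. sqrt (2 * pi * d i))"
    by (rule prod_ennreal) (simp add: d less_imp_le)
  also have "(\<Prod>i\<in>UNIV. sqrt (2 * pi * d i)) = sqrt (\<Prod>i\<in>UNIV. 2 * pi * d i)"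
    by (simp only: real_sqrt_prod)
  also have "(\<Prod>i\<in>UNIV. 2 * pi * d i) = (2 * pi) ^ CARD('n) * det C"
    by (simp add: Ceq det_orthogonal_conj[OF Q] det_diag_mat prod.distrib)
  finally show ?thesis .
qed

section \<open>Moment generating function and second moments\<close>

lemma sets_gaussian [measurable_cong, simp]: "sets (gaussian C) = sets borel"
  by (simp add: gaussian_def)

text \<open>Complete the square by the shift \<open>x = C *v w + y\<close>. The case
  \<open>w = 0\<close> says that \<open>gaussian C\<close> has total mass 1.\<close>

lemma gaussian_mgf_nn_integral:
  fixes C :: "real^'n^'n"
  assumes C: "pos_def C"
  shows "(\<integral>\<^sup>+x. ennreal (exp (w \<bullet> x)) \<partial>gaussian C) = ennreal (exp (w \<bullet> (C *v w) / 2))"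
proof -
  define Z where "Z = sqrt ((2 * pi) ^ CARD('n) * det C)"
  have Z: "0 < Z"
    using pos_def_det_pos[OF C] by (simp add: Z_def)
  let ?P = "matrix_inv C"
  let ?q = "\<lambda>x. exp (- (x \<bullet> (?P *v x)) / 2)"
  have inv: "?P ** C = mat 1" "C ** ?P = mat 1"
    using matrix_inv_mult[OF pos_def_invertible[OF C]] .
  have complete_square: "exp (w \<bullet> (C *v w + y)) * ?q (C *v w + y) = exp (w \<bullet> (C *v w) / 2) * ?q y" for y
  proof -
    have 1: "?P *v (C *v w) = w"
      by (simp add: matrix_vector_mul_assoc inv)
    have 2: "(C *v w) \<bullet> (?P *v y) = w \<bullet> y"
      using pos_def_transpose[OF C]
      by (simp only: inner_matrix_transpose matrix_vector_mul_assoc inv matrix_vector_mul_lid)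
    have "(C *v w + y) \<bullet> (?P *v (C *v w + y)) = w \<bullet> (C *v w) + 2 * (w \<bullet> y) + y \<bullet> (?P *v y)"
      by (simp add: matrix_vector_right_distrib inner_add_left inner_add_right 1 2 inner_commute)
    then show ?thesis
      by (simp add: inner_add_right field_simps flip: exp_add)
  qed
  have [measurable]: "(\<lambda>x. w \<bullet> x) \<in> borel_measurable borel"
    by (intro borel_measurable_continuous_onI continuous_intros)
  have "(\<integral>\<^sup>+x. ennreal (exp (w \<bullet> x)) \<partial>gaussian C) =
      (\<integral>\<^sup>+x. ennreal (?q x / Z) * ennreal (exp (w \<bullet> x)) \<partial>lborel)"
    unfolding gaussian_def Z_def by (subst nn_integral_density) (auto simp: measurable_lborel1)
  also have "\<dots> = (\<integral>\<^sup>+x. ennreal (1 / Z) * ennreal (exp (w \<bullet> x) * ?q x) \<partial>lborel)"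
    using Z by (intro nn_integral_cong) (simp add: mult.commute flip: ennreal_mult)
  also have "\<dots> = ennreal (1 / Z) * (\<integral>\<^sup>+x. ennreal (exp (w \<bullet> x) * ?q x) \<partial>lborel)"
    by (rule nn_integral_cmult) measurable
  also have "(\<integral>\<^sup>+x. ennreal (exp (w \<bullet> x) * ?q x) \<partial>lborel) =
      (\<integral>\<^sup>+y. ennreal (exp (w \<bullet> (C *v w + y)) * ?q (C *v w + y)) \<partial>lborel)"
    by (rule nn_integral_lborel_translate[symmetric]) measurable
  also have "\<dots> = (\<integral>\<^sup>+y. ennreal (exp (w \<bullet> (C *v w) / 2)) * ennreal (?q y) \<partial>lborel)"
    unfolding complete_square by (simp add: ennreal_mult')
  also have "\<dots> = ennreal (exp (w \<bullet> (C *v w) / 2)) * (\<integral>\<^sup>+y. ennreal (?q y) \<partial>lborel)"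
    by (rule nn_integral_cmult) measurable
  also have "(\<integral>\<^sup>+y. ennreal (?q y) \<partial>lborel) = ennreal Z"
    unfolding Z_def by (rule nn_integral_exp_quadratic[OF C])
  finally show ?thesis
    using Z by (simp flip: ennreal_mult)
qed

lemma gaussian_mgf:
  assumes "pos_def C"
  shows "has_bochner_integral (gaussian C) (\<lambda>x. exp (w \<bullet> x)) (exp (w \<bullet> (C *v w) / 2))"
  using gaussian_mgf_nn_integral[OF assms, of w]
  by (intro has_bochner_integral_nn_integral)
    (auto intro!: borel_measurable_continuous_onI continuous_intros
      simp: measurable_cong_sets[OF sets_gaussian refl])

text \<open>The addition formula with cosh at least 1, by induction on \<open>n\<close>. This yields
  the dominating function for the second difference quotients.\<close>

lemma abs_sinh_mult_ge: "real n * \<bar>sinh b\<bar> \<le> \<bar>sinh (real n * b)\<bar>"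
proof -
  have pos: "real n * sinh b \<le> sinh (real n * b)" if "0 \<le> b" for b
  proof (induction n)
    case (Suc n)
    have "sinh (real n * b) * 1 \<le> sinh (real n * b) * cosh b"
      using that by (intro mult_left_mono cosh_real_ge_1) simp
    moreover have "1 * sinh b \<le> cosh (real n * b) * sinh b"
      using that by (intro mult_right_mono cosh_real_ge_1) simp
    moreover have "sinh (real (Suc n) * b) =
        sinh (real n * b) * cosh b + cosh (real n * b) * sinh b"
      using sinh_add[of "real n * b" b] by (simp add: algebra_simps)
    ultimately show ?case
      using Suc by (simp add: distrib_right)
  qed simp
  show ?thesis
    using pos[of "\<bar>b\<bar>"] by (cases "0 \<le> b") auto
qed

text \<open>Second difference quotients of \<open>t \<mapsto> e\<^bsup>ts\<^esup>\<close> at \<open>0\<close>: they give second moments from the moment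
  generating function by dominated convergence.\<close>

lemma second_difference_exp:
  fixes s :: real
  defines "D n \<equiv> (real n)\<^sup>2 * (exp (s / real n) + exp (- s / real n) - 2)"
  shows "0 \<le> D n" and "0 < n \<Longrightarrow> D n \<le> exp s + exp (- s) - 2" and "D \<longlonglongrightarrow> s\<^sup>2"
proof -
  \<comment> \<open>The half-argument identity turns the second difference into a square, from which
    nonnegativity and the bound by the case \<open>n = 1\<close> can be read off.\<close>
  have sinh: "exp t + exp (- t) - 2 = 4 * (sinh (t / 2))\<^sup>2" for t :: real
    using cosh_double[of "t / 2"] cosh_square_eq[of "t / 2"] by (simp add: cosh_def)
  have D: "D n = 4 * (real n * sinh (s / real n / 2))\<^sup>2" for n
    using sinh[of "s / real n"] by (simp add: D_def power_mult_distrib)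
  show "0 \<le> D n"
    by (simp add: D)
  show "D n \<le> exp s + exp (- s) - 2" if "0 < n"
  proof -
    have "\<bar>real n * sinh (s / real n / 2)\<bar> \<le> \<bar>sinh (s / 2)\<bar>"
      using abs_sinh_mult_ge[of n "s / real n / 2"] that by (simp add: abs_mult)
    then show ?thesis
      unfolding D sinh by (simp add: abs_le_square_iff)
  qed
  show "D \<longlonglongrightarrow> s\<^sup>2"
  proof (cases "s = 0")
    case False
    then show ?thesis
      unfolding D_def power2_eq_square[of s] by real_asymp
  next
    case True
    then have "D = (\<lambda>_. 0)"
      by (simp add: D_def fun_eq_iff)
    then show ?thesis
      using True by simp
  qed
qed

text \<open>\<open>D n\<close> is a second difference quotient in direction \<open>w\<close>; it
  tends to \<open>(w \<bullet> x)\<^sup>2\<close> and is dominated by \<open>E\<close>, that is, by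
  \<open>D 1\<close>. Its integral is explicit by the moment generating function and tends to
  \<open>?q\<close>.\<close>

lemma gaussian_second_moment_diag:
  fixes C :: "real^'n^'n"
  assumes C: "pos_def C"
  shows "has_bochner_integral (gaussian C) (\<lambda>x. (w \<bullet> x)\<^sup>2) (w \<bullet> (C *v w))"
proof -
  let ?q = "w \<bullet> (C *v w)"
  define D where "D n x = (real n)\<^sup>2 * (exp (w \<bullet> x / real n) + exp (- (w \<bullet> x) / real n) - 2)" for n x
  define E where "E x = exp (w \<bullet> x) + exp (- (w \<bullet> x)) - 2" for x
  have one: "has_bochner_integral (gaussian C) (\<lambda>x. 1) (1::real)"
    using gaussian_mgf[OF C, of 0] by simp
  have D: "has_bochner_integral (gaussian C) (D n) ((real n)\<^sup>2 * (2 * exp (?q / (real n)\<^sup>2 / 2) - 2))" for n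
  proof -
    have p: "has_bochner_integral (gaussian C) (\<lambda>x. exp (w \<bullet> x / real n)) (exp (?q / (real n)\<^sup>2 / 2))"
      using gaussian_mgf[OF C, of "(1 / real n) *\<^sub>R w"]
      by (simp add: matrix_vector_mult_scaleR power2_eq_square)
    have m: "has_bochner_integral (gaussian C) (\<lambda>x. exp (- (w \<bullet> x) / real n)) (exp (?q / (real n)\<^sup>2 / 2))"
      using gaussian_mgf[OF C, of "(- 1 / real n) *\<^sub>R w"]
      by (simp add: matrix_vector_mult_scaleR power2_eq_square del: scaleR_minus_left)
    have two: "has_bochner_integral (gaussian C) (\<lambda>x. 2) (2::real)"
      using has_bochner_integral_mult_right[OF one, of 2] by simp
    from has_bochner_integral_mult_right[OF
        has_bochner_integral_diff[OF has_bochner_integral_add[OF p m] two], of "(real n)\<^sup>2"]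
    show ?thesis by (simp add: D_def[abs_def])
  qed
  have E: "integrable (gaussian C) E"
    using D[of 1] by (simp add: has_bochner_integral_iff D_def[abs_def] E_def[abs_def])
  have [measurable]: "(\<lambda>x. (w \<bullet> x)\<^sup>2) \<in> borel_measurable (gaussian C)"
    by (subst measurable_cong_sets[OF sets_gaussian refl])
      (intro borel_measurable_continuous_onI continuous_intros)
  \<comment> \<open>The shift to \<open>Suc n\<close> skips \<open>n = 0\<close>, which the
    domination bound does not cover.\<close>
  have Dm: "(\<lambda>x. D (Suc n) x) \<in> borel_measurable (gaussian C)" for n
    using D by (auto simp: has_bochner_integral_iff)
  have lim: "(\<lambda>n. D (Suc n) x) \<longlonglongrightarrow> (w \<bullet> x)\<^sup>2" for x
    using second_difference_exp(3)[of "w \<bullet> x"] unfolding D_def by (rule LIMSEQ_Suc)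
  have dom: "norm (D (Suc n) x) \<le> E x" for n x
    using second_difference_exp(1,2)[of "Suc n" "w \<bullet> x"] by (simp add: D_def E_def)
  have int: "integrable (gaussian C) (\<lambda>x. (w \<bullet> x)\<^sup>2)"
    by (rule integrable_dominated_convergence[where s = "\<lambda>n. D (Suc n)" and w = E])
      (use E Dm lim dom in auto)
  have "(\<lambda>n. integral\<^sup>L (gaussian C) (D (Suc n))) \<longlonglongrightarrow> (\<integral>x. (w \<bullet> x)\<^sup>2 \<partial>gaussian C)"
    by (rule integral_dominated_convergence[where w = E]) (use E Dm lim dom in auto)
  moreover have "(\<lambda>n. integral\<^sup>L (gaussian C) (D (Suc n))) \<longlonglongrightarrow> ?q"
  proof -
    have "integral\<^sup>L (gaussian C) (D n) = (real n)\<^sup>2 * (2 * exp (?q / (real n)\<^sup>2 / 2) - 2)" for n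
      using D by (simp add: has_bochner_integral_iff)
    moreover have "(\<lambda>n. (real n)\<^sup>2 * (2 * exp (?q / (real n)\<^sup>2 / 2) - 2)) \<longlonglongrightarrow> ?q"
    proof (cases "?q = 0")
      case False
      define q where "q = ?q"
      have "q \<noteq> 0" using False by (simp add: q_def)
      then have "(\<lambda>n. (real n)\<^sup>2 * (2 * exp (q / (real n)\<^sup>2 / 2) - 2)) \<longlonglongrightarrow> q"
        by real_asymp
      then show ?thesis by (simp add: q_def)
    next
      case True
      show ?thesis unfolding True by simp
    qed
    ultimately have "(\<lambda>n. integral\<^sup>L (gaussian C) (D n)) \<longlonglongrightarrow> ?q"
      by simp
    then show ?thesis
      by (rule LIMSEQ_Suc)
  qed
  ultimately show ?thesis
    using int LIMSEQ_unique by (simp add: has_bochner_integral_iff) blast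
qed

text \<open>Polarisation of the diagonal case, using the symmetry of \<open>C\<close>.\<close>

lemma gaussian_second_moment:
  fixes C :: "real^'n^'n"
  assumes C: "pos_def C"
  shows "has_bochner_integral (gaussian C) (\<lambda>x. (a \<bullet> x) * (b \<bullet> x)) (a \<bullet> (C *v b))"
proof -
  note d = gaussian_second_moment_diag[OF C]
  have "has_bochner_integral (gaussian C) (\<lambda>x. (1/2) * ((((a + b) \<bullet> x)\<^sup>2 - (a \<bullet> x)\<^sup>2) - (b \<bullet> x)\<^sup>2))
      ((1/2) * (((a + b) \<bullet> (C *v (a + b)) - a \<bullet> (C *v a)) - b \<bullet> (C *v b)))"
    by (intro has_bochner_integral_mult_right has_bochner_integral_diff d)
  moreover have "b \<bullet> (C *v a) = a \<bullet> (C *v b)"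
    using pos_def_vec_mult[OF C, of b] by (metis inner_commute inner_mult_vec)
  ultimately show ?thesis
    by (simp add: inner_add_left inner_add_right matrix_vector_right_distrib power2_eq_square
        algebra_simps)
qed

lemma gaussian_covariance:
  fixes C :: "real^'n^'n"
  assumes "pos_def C"
  shows "has_bochner_integral (gaussian C) (\<lambda>x. x $ i * x $ j) (C $ i $ j)"
proof -
  have "axis i 1 \<bullet> (C *v axis j 1) = C $ i $ j"
    by (simp add: inner_axis' matrix_vector_mul_component inner_axis)
  then show ?thesis
    using gaussian_second_moment[OF assms, of "axis i 1" "axis j 1"] by (simp add: inner_axis')
qed

text \<open>The value is the trace of K^T C, written as a Frobenius inner product.\<close>

lemma gaussian_quadratic_form:
  fixes C K :: "real^'n^'n"
  assumes "pos_def C"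
  shows "has_bochner_integral (gaussian C) (\<lambda>x. x \<bullet> (K *v x)) (K \<bullet> C)"
proof -
  have "has_bochner_integral (gaussian C) (\<lambda>x. \<Sum>i\<in>UNIV. \<Sum>j\<in>UNIV. K $ i $ j * (x $ i * x $ j))
      (\<Sum>i\<in>UNIV. \<Sum>j\<in>UNIV. K $ i $ j * C $ i $ j)"
    by (intro has_bochner_integral_sum has_bochner_integral_mult_right gaussian_covariance assms)
  then show ?thesis
    by (simp add: inner_vec_def matrix_vector_mult_def sum_distrib_left mult_ac)
qed

section \<open>The conditional loss\<close>

lemma inner_matrix_mult_left: "(X ** Y) \<bullet> Z = Y \<bullet> (transpose X ** Z)"
  for X :: "real^'n^'m" and Y :: "real^'k^'n"
proof -
  have "(X ** Y) \<bullet> Z = (\<Sum>i\<in>UNIV. \<Sum>j\<in>UNIV. \<Sum>k\<in>UNIV. X $ i $ k * Y $ k $ j * Z $ i $ j)"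
    by (simp add: inner_vec_def matrix_matrix_mult_def sum_distrib_right)
  also have "\<dots> = (\<Sum>k\<in>UNIV. \<Sum>j\<in>UNIV. \<Sum>i\<in>UNIV. X $ i $ k * Y $ k $ j * Z $ i $ j)"
    by (subst sum.swap, subst (2) sum.swap, subst sum.swap) (rule refl)
  also have "\<dots> = Y \<bullet> (transpose X ** Z)"
    by (simp add: inner_vec_def matrix_matrix_mult_def transpose_def sum_distrib_left mult_ac)
  finally show ?thesis .
qed

lemma inner_transpose: "transpose X \<bullet> transpose Y = X \<bullet> Y" for X Y :: "real^'n^'m"
  unfolding inner_vec_def transpose_def by (simp add: sum.swap[of "\<lambda>i j. X $ j $ i * Y $ j $ i"])

lemma inner_matrix_mult_right: "(X ** Y) \<bullet> Z = X \<bullet> (Z ** transpose Y)"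
  for X :: "real^'n^'m" and Y :: "real^'k^'n"
  using inner_matrix_mult_left[of "transpose Y" "transpose X" "transpose Z"]
    inner_transpose[of "X ** Y" Z] inner_transpose[of X "Z ** transpose Y"]
  by (simp add: matrix_transpose_mul)

text \<open>Test \<open>C\<close> on vectors that are padded with zeros in the other block.\<close>

lemma pos_def_block_uu: "pos_def C \<Longrightarrow> pos_def (block_uu C)"
  and pos_def_block_vv: "pos_def C \<Longrightarrow> pos_def (block_vv C)"
  for C :: "real^('u::finite + 'v::finite)^('u + 'v)"
proof -
  assume C: "pos_def C"
  have sym: "C $ i $ j = C $ j $ i" for i j
    using pos_def_transpose[OF C] by (simp add: transpose_def vec_eq_iff)
  have quad: "0 < (\<Sum>i\<in>UNIV. \<Sum>j\<in>UNIV. w i * (C $ i $ j * w j))" if "w k \<noteq> 0" for w k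
  proof -
    have "(\<chi> i. w i) \<noteq> 0"
      using that by (auto simp: vec_eq_iff)
    then have "0 < (\<chi> i. w i) \<bullet> (C *v (\<chi> i. w i))"
      using C by (simp add: pos_def_def)
    then show ?thesis
      by (simp add: inner_vec_def matrix_vector_mult_def sum_distrib_left)
  qed
  have sum: "(\<Sum>i\<in>UNIV. f i) = (\<Sum>i\<in>UNIV. f (Inl i)) + (\<Sum>j\<in>UNIV. f (Inr j))"
    for f :: "'u + 'v \<Rightarrow> real"
    by (simp add: UNIV_Plus_UNIV[symmetric] sum.Plus del: UNIV_Plus_UNIV)
  show "pos_def (block_uu C)"
    unfolding pos_def_def
  proof (intro conjI allI impI)
    show "transpose (block_uu C) = block_uu C"
      by (simp add: transpose_def block_uu_def vec_eq_iff sym)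
    fix x :: "real^'u" assume "x \<noteq> 0"
    then obtain k where "x $ k \<noteq> 0" by (auto simp: vec_eq_iff)
    then show "0 < x \<bullet> (block_uu C *v x)"
      using quad[of "case_sum (($) x) (\<lambda>_. 0)" "Inl k"]
      by (simp add: sum inner_vec_def matrix_vector_mult_def block_uu_def sum_distrib_left)
  qed
  show "pos_def (block_vv C)"
    unfolding pos_def_def
  proof (intro conjI allI impI)
    show "transpose (block_vv C) = block_vv C"
      by (simp add: transpose_def block_vv_def vec_eq_iff sym)
    fix x :: "real^'v" assume "x \<noteq> 0"
    then obtain k where "x $ k \<noteq> 0" by (auto simp: vec_eq_iff)
    then show "0 < x \<bullet> (block_vv C *v x)"
      using quad[of "case_sum (\<lambda>_. 0) (($) x)" "Inr k"]
      by (simp add: sum inner_vec_def matrix_vector_mult_def block_vv_def sum_distrib_left)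
  qed
qed

section \<open>Evaluation of the three terms of the loss\<close>

text \<open>Pull the integral back to \<open>gaussian C\<close>, where the integrand is a
  combination of products of coordinates with the entries of \<open>block_uv C\<close> as
  expectations.\<close>

lemma integral_joint_gaussian:
  fixes C :: "real^('u::finite + 'v::finite)^('u + 'v)"
  assumes "pos_def C"
  shows "(\<integral>p. fst p \<bullet> (A *v snd p) \<partial>joint_gaussian C) = A \<bullet> block_uv C"
proof -
  let ?g = "\<lambda>w :: real^('u + 'v). (\<chi> i. w $ Inl i, \<chi> j. w $ Inr j) :: (real^'u) \<times> (real^'v)"
  have "?g \<in> borel_measurable borel"
    by (intro borel_measurable_continuous_onI continuous_intros)
  then have g: "?g \<in> measurable (gaussian C) borel"
    by (simp add: measurable_cong_sets[OF sets_gaussian refl])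
  have f: "(\<lambda>p. fst p \<bullet> (A *v snd p)) \<in> borel_measurable borel"
    by (intro borel_measurable_continuous_onI continuous_intros
        linear_continuous_on_compose[OF continuous_on_snd]) auto
  have "(\<integral>p. fst p \<bullet> (A *v snd p) \<partial>joint_gaussian C) =
      (\<integral>w. (\<Sum>i\<in>UNIV. \<Sum>j\<in>UNIV. A $ i $ j * (w $ Inl i * w $ Inr j)) \<partial>gaussian C)"
    unfolding joint_gaussian_def integral_distr[OF g f]
    by (simp add: inner_vec_def matrix_vector_mult_def sum_distrib_left mult_ac)
  also have "\<dots> = (\<Sum>i\<in>UNIV. \<Sum>j\<in>UNIV. A $ i $ j * C $ Inl i $ Inr j)"
    by (intro has_bochner_integral_integral_eq has_bochner_integral_sum
        has_bochner_integral_mult_right gaussian_covariance assms)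
  finally show ?thesis
    by (simp add: inner_vec_def block_uv_def)
qed

text \<open>The moment generating function makes the logarithm half a quadratic form in
  \<open>x\<close>. Both logarithmic terms are instances, with \<open>B\<close> equal to the
  transpose of \<open>A\<close> or to \<open>A\<close>.\<close>

lemma integral_ln_gaussian_mgf:
  fixes P :: "real^'m^'m" and R :: "real^'n^'n" and B :: "real^'m^'n"
  assumes P: "pos_def P" and R: "pos_def R"
  shows "(\<integral>x. ln (\<integral>y. exp ((B *v x) \<bullet> y) \<partial>gaussian R) \<partial>gaussian P) =
    ((transpose B ** R ** B) \<bullet> P) / 2"
proof -
  have "ln (\<integral>y. exp ((B *v x) \<bullet> y) \<partial>gaussian R) = 1 / 2 * (x \<bullet> ((transpose B ** R ** B) *v x))" for x
    using has_bochner_integral_integral_eq[OF gaussian_mgf[OF R, of "B *v x"]]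
    by (simp add: inner_matrix_transpose matrix_vector_mul_assoc[symmetric] del: transpose_matrix_vector)
  then have "(\<integral>x. ln (\<integral>y. exp ((B *v x) \<bullet> y) \<partial>gaussian R) \<partial>gaussian P) =
      1 / 2 * (\<integral>x. x \<bullet> ((transpose B ** R ** B) *v x) \<partial>gaussian P)"
    by (simp only: integral_mult_right_zero)
  then show ?thesis
    using has_bochner_integral_integral_eq[OF gaussian_quadratic_form[OF P, of "transpose B ** R ** B"]]
    by simp
qed

text \<open>Each logarithmic integral equals \<open>?Q / 2\<close>, and the linear term is
  \<open>M \<bullet> (S ** A ** R)\<close>; the loss is thus a squared distance up to a constant
  independent of \<open>A\<close>.\<close>

lemma L_cond_completed_square:
  fixes C :: "real^('u::finite + 'v::finite)^('u + 'v)"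
  assumes C: "pos_def C"
  defines "S \<equiv> msqrt (block_uu C)" and "R \<equiv> msqrt (block_vv C)"
  defines "M \<equiv> matrix_inv S ** block_uv C ** matrix_inv R"
  shows "L_cond C A = 1/2 * (norm (M - S ** A ** R))\<^sup>2 - 1/2 * (norm M)\<^sup>2"
proof -
  note u = pos_def_block_uu[OF C] and v = pos_def_block_vv[OF C]
  have S: "pos_def S" "S ** S = block_uu C" and R: "pos_def R" "R ** R = block_vv C"
    using pos_def_msqrt msqrt_mult_msqrt u v by (auto simp: S_def R_def)
  note inv = matrix_inv_mult[OF pos_def_invertible[OF S(1)]] matrix_inv_mult[OF pos_def_invertible[OF R(1)]]
  note sym = pos_def_transpose[OF S(1)] pos_def_transpose[OF R(1)]
  let ?Q = "(norm (S ** A ** R))\<^sup>2"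
  have 1: "(\<integral>u. ln (\<integral>v. exp (u \<bullet> (A *v v)) \<partial>gaussian (block_vv C)) \<partial>gaussian (block_uu C)) = ?Q / 2"
  proof -
    \<comment> \<open>One factor \<open>R\<close> and one factor \<open>S\<close> are moved across
      the inner product by adjointness, which leaves \<open>S ** A ** R\<close> on both
      sides.\<close>
    have "(A ** (R ** R) ** transpose A) \<bullet> (S ** S) = (A ** R) \<bullet> (S ** S ** A ** R)"
      using inner_matrix_mult_right[of "A ** R" "R ** transpose A" "S ** S"]
      by (simp add: matrix_mul_assoc matrix_transpose_mul sym)
    also have "\<dots> = (S ** A ** R) \<bullet> (S ** A ** R)"
      using inner_matrix_mult_left[of S "A ** R" "S ** A ** R"]
      by (simp add: matrix_mul_assoc sym)
    finally show ?thesis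
      using integral_ln_gaussian_mgf[OF u v, of "transpose A"]
      by (simp add: S(2) R(2) inner_mult_vec power2_norm_eq_inner)
  qed
  have 2: "(\<integral>v. ln (\<integral>u. exp (u \<bullet> (A *v v)) \<partial>gaussian (block_uu C)) \<partial>gaussian (block_vv C)) = ?Q / 2"
  proof -
    have "(transpose A ** (S ** S) ** A) \<bullet> (R ** R) = (S ** A) \<bullet> (S ** A ** R ** R)"
      using inner_matrix_mult_left[of "transpose A ** S" "S ** A" "R ** R"]
      by (simp add: matrix_mul_assoc matrix_transpose_mul sym)
    also have "\<dots> = (S ** A ** R) \<bullet> (S ** A ** R)"
      using inner_matrix_mult_right[of "S ** A" R "S ** A ** R"]
      by (simp add: matrix_mul_assoc sym)
    finally show ?thesis
      using integral_ln_gaussian_mgf[OF v u, of A]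
      by (simp add: S(2) R(2) inner_commute power2_norm_eq_inner)
  qed
  have "S ** M ** R = (S ** matrix_inv S) ** block_uv C ** (matrix_inv R ** R)"
    unfolding M_def by (simp only: matrix_mul_assoc)
  then have SMR: "S ** M ** R = block_uv C"
    by (simp add: inv)
  have "M \<bullet> (S ** A ** R) = (S ** A ** R) \<bullet> M"
    by (rule inner_commute)
  also have "\<dots> = A \<bullet> (S ** M ** R)"
    using inner_matrix_mult_right[of "S ** A" R M] inner_matrix_mult_left[of S A "M ** R"]
    by (simp add: sym matrix_mul_assoc)
  finally have "M \<bullet> (S ** A ** R) = A \<bullet> block_uv C"
    by (simp add: SMR)
  then show ?thesis
    unfolding L_cond_def integral_joint_gaussian[OF C] 1 2 norm_diff_square by (simp add: field_simps)
qed

section \<open>Transfer to approximation of \<open>M\<close> in the Frobenius norm\<close>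

theorem theorem5p1:
  fixes C :: "real^('u::finite + 'v::finite)^('u + 'v)"
  assumes "pos_def C"
  shows "{A. is_arg_min (L_cond C) (\<lambda>_. True) A}
           = {matrix_inv (block_uu C) ** block_uv C ** matrix_inv (block_vv C)}
       \<and> (\<forall>r. 0 < r \<and> r \<le> min CARD('u) CARD('v) \<longrightarrow>
            {A. is_arg_min (L_cond C) (\<lambda>A. rank A \<le> r) A} \<noteq> {} \<and>
            {A. is_arg_min (L_cond C) (\<lambda>A. rank A \<le> r) A}
              = {matrix_inv (msqrt (block_uu C)) ** T ** matrix_inv (msqrt (block_vv C)) | T.
                   svd_truncation r
                     (matrix_inv (msqrt (block_uu C)) ** block_uv C ** matrix_inv (msqrt (block_vv C)))
                     T})"
proof -
  define S where "S = msqrt (block_uu C)"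
  define R where "R = msqrt (block_vv C)"
  define M where "M = matrix_inv S ** block_uv C ** matrix_inv R"
  note u = pos_def_block_uu[OF assms] and v = pos_def_block_vv[OF assms]
  have S: "pos_def S" "S ** S = block_uu C" and R: "pos_def R" "R ** R = block_vv C"
    using pos_def_msqrt msqrt_mult_msqrt u v by (auto simp: S_def R_def)
  note invS = matrix_inv_mult[OF pos_def_invertible[OF S(1)]]
    and invR = matrix_inv_mult[OF pos_def_invertible[OF R(1)]]
  \<comment> \<open>The change of variables: \<open>enc\<close> and \<open>dec\<close> are mutually
    inverse, and neither raises the rank, so the constraint is the same on both sides.\<close>
  define enc where "enc A = S ** A ** R" for A
  define dec where "dec T = matrix_inv S ** T ** matrix_inv R" for T
  have dec_enc: "dec (enc A) = A" for A
  proof -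
    have "dec (enc A) = (matrix_inv S ** S) ** A ** (R ** matrix_inv R)"
      unfolding dec_def enc_def by (simp only: matrix_mul_assoc)
    then show ?thesis by (simp add: invS invR)
  qed
  have enc_dec: "enc (dec T) = T" for T
  proof -
    have "enc (dec T) = (S ** matrix_inv S) ** T ** (matrix_inv R ** R)"
      unfolding dec_def enc_def by (simp only: matrix_mul_assoc)
    then show ?thesis by (simp add: invS invR)
  qed
  have rank_enc: "rank (enc A) \<le> rank A" for A
    unfolding enc_def by (meson order_trans rank_mul_le_left rank_mul_le_right)
  have rank_dec: "rank (dec T) \<le> rank T" for T
    unfolding dec_def by (meson order_trans rank_mul_le_left rank_mul_le_right)
  have norm_less: "(norm x)\<^sup>2 < (norm y)\<^sup>2 \<longleftrightarrow> norm x < norm y" for x y :: "real^'v^'u"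
    by (meson norm_ge_zero power2_less_imp_less power_strict_mono zero_less_numeral)
  have L_less: "L_cond C A < L_cond C B \<longleftrightarrow> norm (M - enc A) < norm (M - enc B)" for A B
    using L_cond_completed_square[OF assms] by (simp add: M_def enc_def S_def R_def norm_less)
  have arg_min: "is_arg_min (L_cond C) P A \<longleftrightarrow> P A \<and> (\<forall>B. P B \<longrightarrow> norm (M - enc A) \<le> norm (M - enc B))"
    for P A
    unfolding is_arg_min_def L_less by (auto simp: not_less)
  have "{A. is_arg_min (L_cond C) (\<lambda>_. True) A} = {dec M}"
  proof -
    have "(\<forall>B. norm (M - enc A) \<le> norm (M - enc B)) \<longleftrightarrow> A = dec M" for A
    proof
      assume "\<forall>B. norm (M - enc A) \<le> norm (M - enc B)"
      then have "norm (M - enc A) \<le> norm (M - enc (dec M))" by blast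
      then show "A = dec M"
        using dec_enc[of A] by (simp add: enc_dec)
    qed (simp add: enc_dec)
    then show ?thesis
      unfolding arg_min by auto
  qed
  also have "dec M = matrix_inv (block_uu C) ** block_uv C ** matrix_inv (block_vv C)"
  proof -
    \<comment> \<open>Two inverse square roots on either side of \<open>block_uv C\<close> combine
      to the inverse covariances of the unconstrained minimiser.\<close>
    have square: "matrix_inv (X ** X) = matrix_inv X ** matrix_inv X" if "pos_def X" for X :: "real^'k^'k"
    proof (rule matrix_inv_eqI)
      note inv = matrix_inv_mult[OF pos_def_invertible[OF that]]
      have "(X ** X) ** (matrix_inv X ** matrix_inv X) = X ** (X ** matrix_inv X) ** matrix_inv X"
        by (simp only: matrix_mul_assoc)
      then show "(X ** X) ** (matrix_inv X ** matrix_inv X) = mat 1"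
        by (simp add: inv)
    qed
    show ?thesis
      using square[OF S(1)] square[OF R(1)] by (simp add: dec_def M_def S(2) R(2) matrix_mul_assoc)
  qed
  finally have full: "{A. is_arg_min (L_cond C) (\<lambda>_. True) A}
      = {matrix_inv (block_uu C) ** block_uv C ** matrix_inv (block_vv C)}" .
  have low_rank: "{A. is_arg_min (L_cond C) (\<lambda>A. rank A \<le> r) A} = {dec T | T. svd_truncation r M T}"
    if r: "0 < r" "r \<le> min CARD('u) CARD('v)" for r
  proof (intro set_eqI iffI)
    fix A assume "A \<in> {A. is_arg_min (L_cond C) (\<lambda>A. rank A \<le> r) A}"
    then have rank: "rank A \<le> r" and min: "\<And>B. rank B \<le> r \<Longrightarrow> norm (M - enc A) \<le> norm (M - enc B)"
      by (auto simp: arg_min)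
    \<comment> \<open>A competitor \<open>T\<close> for \<open>enc A\<close> comes from the matrix
      \<open>dec T\<close>, against which \<open>A\<close> is known to be optimal.\<close>
    have "svd_truncation r M (enc A)"
    proof (rule low_rank_minimizer_is_truncation[OF r])
      show "rank (enc A) \<le> r"
        using rank_enc rank by (rule order_trans)
      show "norm (M - enc A) \<le> norm (M - T)" if "rank T \<le> r" for T
        using min[OF order_trans[OF rank_dec that]] by (simp add: enc_dec)
    qed
    then show "A \<in> {dec T | T. svd_truncation r M T}"
      using dec_enc[of A] by force
  next
    fix A assume "A \<in> {dec T | T. svd_truncation r M T}"
    then obtain T where T: "svd_truncation r M T" "A = dec T" by blast
    have "rank A \<le> r"
      unfolding T(2) using rank_dec rank_svd_truncation_le[OF T(1)] by (rule order_trans)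
    moreover have "norm (M - enc A) \<le> norm (M - enc B)" if "rank B \<le> r" for B
      unfolding T(2) enc_dec
      by (rule svd_truncation_optimal[OF T(1) r(2) order_trans[OF rank_enc that]])
    ultimately show "A \<in> {A. is_arg_min (L_cond C) (\<lambda>A. rank A \<le> r) A}"
      by (simp add: arg_min)
  qed
  have "{dec T | T. svd_truncation r M T} \<noteq> {}" for r
    using svd_truncation_exists[of r M] by blast
  with full low_rank show ?thesis
    unfolding dec_def M_def S_def R_def by simp
qed

end
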